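(* Let $p\in(0,\infty]$ and $b>0$, and let $X=\{x_k\}_{k\in\mathbb{Z}}\subset\mathbb{R}$ be a separated sequence with $D(X)<2b$. (1) There is a function $f\in PW_b^p$, real-valued on $\mathbb{R}$, that is not uniquely determined up to a sign factor by the values $|f(x_k)|$; that is, there is some $g\in PW_b^p$, real-valued on $\mathbb{R}$, with $|g(x_k)|=|f(x_k)|$ for all $k\in\mathbb{Z}$, but $g\ne f$ and $g\neq -f$. (2) If in addition $D(X)>\frac43 b$, then there is a function $\tilde f\in PW_b^p$, real-valued on $\mathbb{R}$, such that both of the following hold: (a) $\tilde f$ is uniquely determined up to a sign factor by the values $|\tilde f(x_k)|$; that is, if $g\in PW_b^p$ is real-valued on $\mathbb{R}$ and $|g(x_k)|=|\tilde f(x_k)|$ for all $k\in\mathbb{Z}$, then $g=\tilde f$ or $g=-\tilde f$; (b) there is no subsequence $Y=\{y_k\}\subset X$ such that $\tilde f(y_k)=0$ for all $k$ and $\lim_{r\to\infty}\frac{N(Y,[-r,r])}{2r}\ge b$.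
   Context: The Fourier transform is normalized as $\hat f(\omega)=\int_{-\infty}^{\infty}f(t)e^{-2\pi i\omega t}\,dt$ for Schwartz functions and extended to tempered distributions in the usual way. For $0<p\le\infty$ and $b>0$, the Paley-Wiener space is $PW_b^p=\{f\in L^p(\mathbb{R}):\operatorname{supp}(\hat f)\subset[-\tfrac b2,\tfrac b2]\}$ (complex-valued functions). Equivalently (Paley-Wiener-Schwartz), $PW_b^p$ is the space of all entire functions $f$ of exponential type at most $\pi b$ whose restrictions to $\mathbb{R}$ are in $L^p$; elements are identified with these entire functions, so point values make sense. The exponential type of an entire function $g$ is $\inf\{\beta: |g(z)|\le e^{\beta|z|},\ z\in\mathbb{C}\}$, understood in the usual sense, i.e. up to a multiplicative constant. A sequence $X=\{x_k\}_{k\in\mathbb{Z}}\subset\mathbb{R}$ is indexed so that $x_k<x_{k+1}$. It is separated if $\inf_k|x_{k+1}-x_k|>0$. It is uniformly dense if $\sup_k|x_k-\tfrac kd|<\infty$ for some finite $d>0$; in this case one writes $D(X)=d$, and one writes $D(X)=\infty$ if $X$ is not uniformly dense. (Thus $D(X)<2b$ entails that $X$ is uniformly dense.) For a set $B$ and a sequence $Y$, $N(Y,B)$ denotes the number of terms of $Y$ lying in $B$. *)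

theory Defs
  imports "HOL-Complex_Analysis.Complex_Analysis"
begin

definition Lp_fun :: "ennreal \<Rightarrow> (real \<Rightarrow> complex) \<Rightarrow> bool" where
  "Lp_fun p f \<longleftrightarrow> f \<in> borel_measurable lborel \<and>
     (if p = \<infinity> then (\<exists>C. AE t in lborel. cmod (f t) \<le> C)
      else integrable lborel (\<lambda>t. cmod (f t) powr enn2real p))"

text \<open>
  The infimum is taken in the extended reals, so that it is \<open>\<infinity>\<close> for functions that are not of
  exponential type, and \<open>-\<infinity>\<close> for the zero function (the infimum in \<open>real\<close> of an empty or
  unbounded set would be an arbitrary number).
\<close>

definition exponential_type :: "(complex \<Rightarrow> complex) \<Rightarrow> ereal" where
  "exponential_type g =
     (INF \<beta> \<in> {\<beta>::real. \<exists>C. \<forall>z. cmod (g z) \<le> C * exp (\<beta> * cmod z)}. ereal \<beta>)"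

text \<open>
  The elements of the Paley-Wiener space (spectrum in \<open>[-b/2, b/2]\<close> for the Fourier transform with
  kernel \<open>exp (- 2 \<pi> \<i> \<omega> t)\<close>) are identified with their entire extensions, of exponential type at
  most \<open>\<pi> b\<close>.  For \<open>p < 1\<close> functions in \<open>L\<^sup>p\<close> need not be distributions, but this form of the
  definition makes sense for every \<open>p\<close>.
\<close>

definition PW :: "ennreal \<Rightarrow> real \<Rightarrow> (complex \<Rightarrow> complex) set" where
  "PW p b = {f. f holomorphic_on UNIV \<and> exponential_type f \<le> ereal (pi * b) \<and>
                Lp_fun p (\<lambda>t. f (complex_of_real t))}"

definition real_on_reals :: "(complex \<Rightarrow> complex) \<Rightarrow> bool" where
  "real_on_reals f \<longleftrightarrow> (\<forall>t::real. f (complex_of_real t) \<in> \<real>)"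

definition separated_seq :: "(int \<Rightarrow> real) \<Rightarrow> bool" where
  "separated_seq x \<longleftrightarrow> (INF k. \<bar>x (k + 1) - x k\<bar>) > 0"

definition uniformly_dense_with :: "(int \<Rightarrow> real) \<Rightarrow> real \<Rightarrow> bool" where
  "uniformly_dense_with x d \<longleftrightarrow> d > 0 \<and> bdd_above (range (\<lambda>k. \<bar>x k - of_int k / d\<bar>))"

definition seq_density :: "(int \<Rightarrow> real) \<Rightarrow> ereal" where
  "seq_density x =
     (if \<exists>d. uniformly_dense_with x d then ereal (THE d. uniformly_dense_with x d) else \<infinity>)"

lemma uniformly_dense_with_unique:
  assumes "uniformly_dense_with x d" "uniformly_dense_with x e"
  shows "d = e"
proof (rule ccontr)
  assume "d \<noteq> e"
  obtain A B where A: "\<And>k. \<bar>x k - of_int k / d\<bar> \<le> A" and B: "\<And>k. \<bar>x k - of_int k / e\<bar> \<le> B"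
    using assms by (auto simp: uniformly_dense_with_def bdd_above_def)
  define c where "c = \<bar>1 / d - 1 / e\<bar>"
  have "c > 0"
    using assms \<open>d \<noteq> e\<close> by (auto simp: c_def uniformly_dense_with_def)
  then obtain n :: nat where n: "A + B < real n * c"
    using reals_Archimedean3 by blast
  have "real n * c = \<bar>real n * (1 / d - 1 / e)\<bar>"
    unfolding c_def abs_mult by simp
  also have "\<dots> = \<bar>real n / d - real n / e\<bar>"
    by (simp add: right_diff_distrib)
  also have "\<dots> \<le> A + B"
    using A[of "int n"] B[of "int n"] by (simp add: abs_le_iff)
  finally show False using n by simp
qed

lemma seq_density_eq:
  "uniformly_dense_with x d \<Longrightarrow> seq_density x = ereal d"
  unfolding seq_density_def using uniformly_dense_with_unique by (auto intro!: the_equality)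

definition count_in :: "real set \<Rightarrow> real set \<Rightarrow> nat" where
  "count_in Y B = card (Y \<inter> B)"

end

theory Submission
  imports Defs "HOL-Probability.Sinc_Integral"
begin

text \<open>
  Since \<open>\<bar>f\<bar> = \<bar>g\<bar>\<close> on \<open>X\<close> means \<open>(f - g) (f + g) = 0\<close> there, and the even- and the odd-indexed points
  of \<open>X\<close> both have density \<open>d / 2 < b\<close>, there are nonzero \<open>u\<close>, \<open>v\<close> in the Paley-Wiener space that vanish
  on the even and on the odd points, respectively; \<open>f = u + v\<close> and \<open>g = u - v\<close> then prove (1).
  The functions \<open>u\<close>, \<open>v\<close> are canonical products, dominated by a power of \<open>\<bar>z\<bar>\<close> times a sine, multiplied by
  a power of a sinc function of small type.

  For (2) take \<open>u\<close> itself. If \<open>\<bar>g\<bar> = \<bar>u\<bar>\<close> on \<open>X\<close>, then \<open>g\<^sup>2 - u\<^sup>2\<close> has double zeros at the even points and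
  simple zeros at the odd points, a total density \<open>3 d / 2 > 2 b\<close>, while its exponential type is at
  most \<open>2 \<pi> b\<close>; by Carlson's theorem it vanishes. The zeros of \<open>u\<close> are the even points and those of the
  sinc factor, and together they have density less than \<open>b\<close>.
\<close>

section \<open>Carlson's theorem for real zeros\<close>

text \<open>The number 4/3 is the break-even point of a zero count: three zeros of g^2 - u^2 for
  every two points give density 3d/2, which exceeds 2b exactly when d > 4b/3. The threshold is of
  Carlson type: sin(tau z) has type tau and zeros of density tau/pi on a half line, and a nonzero
  function of type tau cannot have denser ones. So zeros on one half line suffice, and the two-sided
  sequence is cut to a positive tail. Both strict inequalities are spent. The type is an infimum, so
  growth is controlled only with exponents slightly above pi b; d > 4b/3 absorbs this excess. And
  d/2 < b leaves spare type for the sinc factor. That factor is there because points at bounded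
  distance from a lattice give a product that may exceed the sine by a power of |z|, and because
  small p requires fast decay on top. Its zeros may belong to X, so its frequency must be small for
  (b).\<close>

lemma isCont_mult_Ln_0: "isCont (\<lambda>z. z * Ln z) 0"
proof -
  have "((\<lambda>r::real. r * (\<bar>ln r\<bar> + pi)) \<longlongrightarrow> 0) (at_right 0)"
  proof -
    have "((\<lambda>r::real. r * \<bar>ln r\<bar>) \<longlongrightarrow> 0) (at_right 0)" by real_asymp
    moreover have "((\<lambda>r::real. r * pi) \<longlongrightarrow> 0) (at_right 0)" by real_asymp
    ultimately show ?thesis
      by (auto simp: distrib_left intro: tendsto_eq_intros)
  qed
  moreover have "filterlim cmod (at_right 0) (at (0::complex))"
    by (auto simp: filterlim_at eventually_at_filter intro!: tendsto_eq_intros)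
  ultimately have lim: "((\<lambda>z::complex. cmod z * (\<bar>ln (cmod z)\<bar> + pi)) \<longlongrightarrow> 0) (at 0)"
    by (rule filterlim_compose)
  have bound: "cmod (z * Ln z) \<le> cmod z * (\<bar>ln (cmod z)\<bar> + pi)" if "z \<noteq> 0" for z
  proof -
    have "cmod (Ln z) \<le> \<bar>Re (Ln z)\<bar> + \<bar>Im (Ln z)\<bar>"
      by (rule cmod_le)
    also have "\<dots> \<le> \<bar>ln (cmod z)\<bar> + pi"
      using that mpi_less_Im_Ln[OF that] Im_Ln_le_pi[OF that] by (auto simp: abs_le_iff)
    finally show ?thesis
      by (simp add: norm_mult mult_left_mono)
  qed
  have "((\<lambda>z. z * Ln z) \<longlongrightarrow> 0) (at 0)"
    by (rule Lim_null_comparison[OF _ lim]) (auto simp: eventually_at_filter bound)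
  then show ?thesis
    by (simp add: isCont_def)
qed

text \<open>Jordan's inequality: by concavity the graph of the sine lies above its chord from 0 to
  pi/2.\<close>

lemma sin_ge_linear:
  assumes "0 \<le> u" "u \<le> pi / 2"
  shows "2 / pi * u \<le> sin (u::real)"
proof -
  have "convex_on {0..pi} (\<lambda>x. - sin x)"
    by (rule f''_ge0_imp_convex[where f' = "\<lambda>x. - cos x" and f'' = sin])
      (auto intro!: derivative_eq_intros sin_ge_zero)
  from convex_onD[OF this, of "2 / pi * u" 0 "pi / 2"] show ?thesis
    using assms by (simp add: field_simps)
qed

text \<open>
  A harmonic majorant of \<open>\<bar>z\<bar>\<close> on the boundary of the right half disc of radius \<open>R\<close>: the function
  \<open>- (2/\<pi>) Re (z Ln z)\<close> equals \<open>\<bar>z\<bar>\<close> on the imaginary axis, and the linear term takes care of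
  the arc.  At points of the positive axis it is only of size \<open>ln R\<close>.
\<close>

definition half_disc_majorant :: "real \<Rightarrow> complex \<Rightarrow> complex" where
  "half_disc_majorant R z = of_real (2 + 2 / pi * ln R) * z - of_real (2 / pi) * (z * Ln z)"

text \<open>On the imaginary axis Im z * Arg z = |z| pi/2. On the arc the logarithms cancel, and
  with s = 2 |Arg z| / pi Jordan's inequality, used for cosine and sine, reduces the claim to 2 (1 -
  s) + s^2 = 1 + (1 - s)^2 >= 1; this is where the constant 2 in the linear term comes from.\<close>

lemma Re_half_disc_majorant_ge:
  assumes z: "Re z \<ge> 0" and R: "R > 0" and bd: "Re z = 0 \<or> cmod z = R"
  shows "Re (half_disc_majorant R z) \<ge> cmod z"
proof (cases "z = 0")
  case True
  then show ?thesis by (simp add: half_disc_majorant_def)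
next
  case False
  define r \<theta> where "r = cmod z" and "\<theta> = Arg z"
  have r: "r > 0" using False by (simp add: r_def)
  have zr: "Re z = r * cos \<theta>" "Im z = r * sin \<theta>"
    using False by (auto simp: r_def \<theta>_def cos_Arg sin_Arg)
  have Ln: "Re (Ln z) = ln r" "Im (Ln z) = \<theta>"
    using False by (auto simp: r_def \<theta>_def Arg_eq_Im_Ln)
  have ReU: "Re (half_disc_majorant R z) =
      2 * Re z + 2 / pi * Re z * (ln R - ln r) + 2 / pi * (Im z * \<theta>)"
    by (simp add: half_disc_majorant_def Ln field_simps)
  have \<theta>: "\<bar>\<theta>\<bar> \<le> pi / 2"
    using z Arg_Re_nonneg[of z] by (simp add: \<theta>_def)
  have sin_ge: "sin u \<ge> 2 / pi * u" if "0 \<le> u" "u \<le> pi / 2" for u :: real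
    using sin_ge_linear that by simp
  show ?thesis
  proof (cases "Re z = 0")
    case True
    then have "cos \<theta> = 0" using zr r by simp
    then have "\<bar>\<theta>\<bar> = pi / 2"
      using \<theta> cos_gt_zero_pi[of \<theta>] by linarith
    then have "\<theta> = pi / 2 \<or> \<theta> = - (pi / 2)" by linarith
    then have "sin \<theta> * \<theta> = pi / 2"
      by (elim disjE; simp only: sin_minus sin_pi_half mult_1 mult_minus1 minus_minus)
    then have "Im z * \<theta> = r * (pi / 2)" unfolding zr by simp
    then show ?thesis
      unfolding ReU using True by (simp add: r_def field_simps)
  next
    case False
    with bd have "r = R" by (simp add: r_def)
    define s where "s = 2 / pi * \<bar>\<theta>\<bar>"
    have s: "0 \<le> s" "s \<le> 1" using \<theta> by (auto simp: s_def field_simps)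
    have "sin \<theta> * \<theta> = sin \<bar>\<theta>\<bar> * \<bar>\<theta>\<bar>" by (simp add: abs_if)
    also have "\<dots> \<ge> s * \<bar>\<theta>\<bar>"
      using sin_ge[of "\<bar>\<theta>\<bar>"] \<theta> by (intro mult_right_mono) (auto simp: s_def)
    finally have "2 / pi * (sin \<theta> * \<theta>) \<ge> 2 / pi * (s * \<bar>\<theta>\<bar>)"
      by (intro mult_left_mono) auto
    then have 1: "2 / pi * (sin \<theta> * \<theta>) \<ge> s\<^sup>2"
      by (simp add: s_def power2_eq_square mult_ac)
    have "cos \<theta> = sin (pi / 2 - \<bar>\<theta>\<bar>)"
      by (simp add: sin_diff abs_if)
    also have "\<dots> \<ge> 2 / pi * (pi / 2 - \<bar>\<theta>\<bar>)"
      using \<theta> by (intro sin_ge) auto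
    finally have 2: "cos \<theta> \<ge> 1 - s"
      by (simp add: s_def field_simps)
    have "1 \<le> 1 + (1 - s)\<^sup>2" by simp
    also have "\<dots> = 2 * (1 - s) + s\<^sup>2"
      by (simp add: power2_eq_square algebra_simps)
    also have "\<dots> \<le> 2 * cos \<theta> + 2 / pi * (sin \<theta> * \<theta>)"
      using 1 2 by simp
    finally have "r * 1 \<le> r * (2 * cos \<theta> + 2 / pi * (sin \<theta> * \<theta>))"
      using r by (intro mult_left_mono) auto
    then show ?thesis
      unfolding ReU using \<open>r = R\<close> zr by (simp add: r_def[symmetric] algebra_simps)
  qed
qed

text \<open>Maximum principle for \<open>F\<close> divided by the Blaschke factors of its zeros and
  by the exponential of the majorant. The Blaschke factor of the half disc comes from reflection:
  zeros at a and -R^2/a, poles at -a and R^2/a. Its modulus is 1 on the whole boundary, so at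
  \<open>t\<close> the factors are pure gain.\<close>

lemma half_disc_bound:
  fixes F G :: "complex \<Rightarrow> complex" and a :: "'i \<Rightarrow> real"
  assumes holG: "G holomorphic_on UNIV" and I: "finite I"
    and F: "\<And>z. F z = (\<Prod>i\<in>I. z - of_real (a i)) * G z"
    and bound: "\<And>z. cmod (F z) \<le> C * exp (\<tau> * cmod z)" and "\<tau> \<ge> 0"
    and a: "\<And>i. i \<in> I \<Longrightarrow> 0 < a i \<and> a i < R"
    and t: "0 < t" "t < R"
  shows "cmod (F (of_real t)) \<le> C * exp (\<tau> * (2 * t + 2 / pi * t * (ln R - ln t))) *
      (\<Prod>i\<in>I. \<bar>t - a i\<bar> / (t + a i) * ((R\<^sup>2 + a i * t) / (R\<^sup>2 - a i * t)))"
proof -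
  have R: "R > 0" using t by simp
  define S where "S = {z. Re z > 0} \<inter> ball 0 R"
  \<comment> \<open>\<open>z - a\<^sub>i\<close> divided by the Blaschke factor of the half disc with zero \<open>a\<^sub>i\<close>\<close>
  define q where "q i z = (z + of_real (a i)) * (of_real (R\<^sup>2) - of_real (a i) * z) /
      (of_real (R\<^sup>2) + of_real (a i) * z)" for i and z :: complex
  define \<Phi> where "\<Phi> z = G z * (\<Prod>i\<in>I. q i z) * exp (- of_real \<tau> * half_disc_majorant R z)" for z
  have [simp]: "open S"
    by (auto simp: S_def open_halfspace_Re_gt)
  have "closure S \<subseteq> {z. Re z \<ge> 0} \<inter> cball 0 R"
    unfolding S_def
    by (intro closure_minimal closed_Int closed_halfspace_Re_ge) auto
  then have clS: "Re z \<ge> 0" "cmod z \<le> R" if "z \<in> closure S" for z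
    using that by auto
  have denom: "Re (of_real (R\<^sup>2) + of_real (a i) * z) > 0" if "i \<in> I" "Re z \<ge> 0" for i z
    using a[OF that(1)] that(2) R by (auto intro!: add_pos_nonneg)
  then have nz: "of_real (R\<^sup>2) + of_real (a i) * z \<noteq> 0" if "i \<in> I" "Re z \<ge> 0" for i z
    using that by (metis less_irrefl zero_complex.simps(1))
  have "half_disc_majorant R holomorphic_on S"
    unfolding half_disc_majorant_def S_def
    by (intro holomorphic_intros) (auto simp: complex_nonpos_Reals_iff)
  moreover have "q i holomorphic_on S" if "i \<in> I" for i
    unfolding q_def using nz[OF that] by (intro holomorphic_intros) (auto simp: S_def)
  ultimately have hol: "\<Phi> holomorphic_on interior S"
    unfolding \<Phi>_def using holG
    by (auto intro!: holomorphic_intros intro: holomorphic_on_subset simp: interior_open)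
  have "continuous_on (closure S) (half_disc_majorant R)"
  proof -
    \<comment> \<open>In the closed half disc \<open>Ln\<close> is singular only at the origin,
      where the factor \<open>z\<close> restores continuity.\<close>
    have "isCont (\<lambda>z. z * Ln z) z" if "z \<in> closure S" for z
    proof (cases "z = 0")
      case False
      then have "z \<notin> \<real>\<^sub>\<le>\<^sub>0"
        using clS(1)[OF that] by (auto simp: complex_nonpos_Reals_iff complex_eq_iff)
      then show ?thesis
        by (intro continuous_intros)
    qed (use isCont_mult_Ln_0 in auto)
    then have "continuous_on (closure S) (\<lambda>z. z * Ln z)"
      by (simp add: continuous_at_imp_continuous_on)
    then show ?thesis
      unfolding half_disc_majorant_def
      by (intro continuous_on_diff continuous_on_mult_left continuous_on_id)
  qed
  moreover have "continuous_on (closure S) (q i)" if "i \<in> I" for i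
    unfolding q_def using nz[OF that] clS by (intro continuous_intros) auto
  moreover have "continuous_on (closure S) G"
    using holG holomorphic_on_imp_continuous_on continuous_on_subset by blast
  ultimately have cont: "continuous_on (closure S) \<Phi>"
    unfolding \<Phi>_def by (auto intro!: continuous_intros)
  have "cmod (\<Phi> z) \<le> C" if "z \<in> frontier S" for z
  proof -
    have z: "z \<in> closure S" "z \<notin> S"
      using that by (auto simp: frontier_def interior_open)
    then have bd: "Re z = 0 \<or> cmod z = R" and z0: "Re z \<ge> 0"
      using clS[OF z(1)] by (auto simp: S_def)
    \<comment> \<open>On the axis, reflection in it preserves moduli; on the arc, writing R^2 as
      \<open>z * cnj z\<close> turns the quadratic factors into R times the moduli of the linear
      ones.\<close>
    have "cmod (q i z) = cmod (z - of_real (a i))" if i: "i \<in> I" for i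
    proof -
      let ?A = "of_real (a i) :: complex"
      note ai = a[OF i]
      from bd show ?thesis
      proof
        assume "Re z = 0"
        then have "cmod (of_real (R\<^sup>2) - ?A * z) = cmod (of_real (R\<^sup>2) + ?A * z)"
          "cmod (z + ?A) = cmod (z - ?A)"
          by (simp_all add: cmod_def)
        then show ?thesis
          unfolding q_def norm_mult norm_divide using nz[OF i z0] by simp
      next
        assume zR: "cmod z = R"
        have RR: "of_real (R\<^sup>2) = z * cnj z"
          using complex_norm_square[of z] zR by simp
        have "of_real (R\<^sup>2) - ?A * z = z * cnj (z - ?A)" "of_real (R\<^sup>2) + ?A * z = z * cnj (z + ?A)"
          unfolding RR by (simp_all add: algebra_simps)
        then have "cmod (of_real (R\<^sup>2) - ?A * z) = R * cmod (z - ?A)"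
            "cmod (of_real (R\<^sup>2) + ?A * z) = R * cmod (z + ?A)"
          by (simp_all only: norm_mult complex_mod_cnj zR)
        moreover have "Re (z + ?A) > 0" using z0 ai by simp
        then have "z + ?A \<noteq> 0" by (metis less_irrefl zero_complex.simps(1))
        ultimately show ?thesis
          unfolding q_def norm_mult norm_divide using R by simp
      qed
    qed
    then have "cmod (\<Phi> z) = cmod (F z) * exp (- \<tau> * Re (half_disc_majorant R z))"
      by (simp add: \<Phi>_def F norm_mult prod_norm[symmetric])
    also have "\<dots> \<le> cmod (F z) * exp (- \<tau> * cmod z)"
      using Re_half_disc_majorant_ge[OF z0 R bd] \<open>\<tau> \<ge> 0\<close>
      by (intro mult_left_mono) (auto intro: mult_left_mono)
    also have "\<dots> \<le> C * exp (\<tau> * cmod z) * exp (- \<tau> * cmod z)"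
      by (intro mult_right_mono bound) auto
    also have "\<dots> = C" by (simp add: exp_minus field_simps)
    finally show ?thesis .
  qed
  note frontier = this
  have \<Phi>t: "cmod (\<Phi> (of_real t)) \<le> C"
  proof (rule maximum_modulus_frontier[OF hol cont _ frontier])
    show "bounded S"
      unfolding S_def by (rule bounded_subset[OF bounded_ball]) auto
    show "of_real t \<in> S" using t by (simp add: S_def)
  qed
  have at: "a i * t < R\<^sup>2" if "i \<in> I" for i
    unfolding power2_eq_square using a[OF that] t by (intro mult_strict_mono) auto
  have qt: "cmod (of_real t - of_real (a i)) = \<bar>t - a i\<bar> / (t + a i) *
      ((R\<^sup>2 + a i * t) / (R\<^sup>2 - a i * t)) * cmod (q i (of_real t))" if "i \<in> I" for i
  proof -
    have "q i (of_real t) = of_real ((t + a i) * (R\<^sup>2 - a i * t) / (R\<^sup>2 + a i * t))"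
      by (simp add: q_def)
    then have "cmod (q i (of_real t)) = (t + a i) * (R\<^sup>2 - a i * t) / (R\<^sup>2 + a i * t)"
      using a[OF that] t at[OF that] by (simp only: norm_of_real) (simp add: abs_mult)
    moreover have "cmod (of_real t - of_real (a i)) = \<bar>t - a i\<bar>"
      by (metis norm_of_real of_real_diff)
    moreover have "t + a i > 0" "R\<^sup>2 - a i * t > 0" "R\<^sup>2 + a i * t > 0"
      using a[OF that] t at[OF that] R by (auto intro!: add_pos_pos)
    moreover have "d = d / A * (P / M) * (A * M / P)" if "A > 0" "M > 0" "P > 0" for d A M P :: real
      using that by simp
    ultimately show ?thesis by simp
  qed
  have U: "half_disc_majorant R (of_real t) = of_real (2 * t + 2 / pi * t * (ln R - ln t))"
    using t by (simp add: half_disc_majorant_def Ln_of_real algebra_simps diff_divide_distrib)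
  have "cmod (F (of_real t)) = (\<Prod>i\<in>I. cmod (of_real t - of_real (a i))) * cmod (G (of_real t))"
    by (simp add: F norm_mult prod_norm)
  also have "(\<Prod>i\<in>I. cmod (of_real t - of_real (a i))) = (\<Prod>i\<in>I. \<bar>t - a i\<bar> / (t + a i) *
      ((R\<^sup>2 + a i * t) / (R\<^sup>2 - a i * t))) * (\<Prod>i\<in>I. cmod (q i (of_real t)))"
    unfolding prod.distrib[symmetric] by (intro prod.cong refl qt) auto
  also have "\<dots> * cmod (G (of_real t)) = cmod (\<Phi> (of_real t)) *
      exp (\<tau> * (2 * t + 2 / pi * t * (ln R - ln t))) * (\<Prod>i\<in>I. \<bar>t - a i\<bar> / (t + a i) *
      ((R\<^sup>2 + a i * t) / (R\<^sup>2 - a i * t)))"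
    by (simp add: \<Phi>_def U norm_mult prod_norm flip: exp_add of_real_mult of_real_minus)
  also have "\<dots> \<le> C * exp (\<tau> * (2 * t + 2 / pi * t * (ln R - ln t))) *
      (\<Prod>i\<in>I. \<bar>t - a i\<bar> / (t + a i) * ((R\<^sup>2 + a i * t) / (R\<^sup>2 - a i * t)))"
    using a t at R
    by (intro mult_right_mono \<Phi>t prod_nonneg ballI mult_nonneg_nonneg divide_nonneg_nonneg)
      (auto simp: less_imp_le intro: add_nonneg_nonneg)
  finally show ?thesis .
qed

text \<open>The logarithm of (1 + s)/(1 - s) has derivative 2/(1 - s^2) >= 2. With s = t/a this is
  the gain from a zero at a.\<close>

lemma one_minus_div_one_plus_le_exp:
  assumes "0 \<le> s" "s < (1::real)"
  shows "(1 - s) / (1 + s) \<le> exp (- 2 * s)"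
proof -
  have "ln (1 + 0) - ln (1 - 0) - 2 * 0 \<le> ln (1 + s) - ln (1 - s) - 2 * s"
  proof (rule DERIV_nonneg_imp_nondecreasing[OF assms(1)])
    fix u assume u: "0 \<le> u" "u \<le> s"
    then have "u < 1" using assms by simp
    then have "2 \<le> 1 / (1 + u) + 1 / (1 - u)"
    proof -
      have "u * u < 1" using u \<open>u < 1\<close> mult_strict_mono[of u 1 u 1] by simp
      then have "2 / 1 \<le> 2 / (1 - u * u)" by (intro frac_le) auto
      also have "2 / (1 - u * u) = 1 / (1 + u) + 1 / (1 - u)"
        using u \<open>u < 1\<close> by (simp add: field_simps)
      finally show ?thesis by simp
    qed
    then show "\<exists>y. ((\<lambda>u. ln (1 + u) - ln (1 - u) - 2 * u) has_real_derivative y) (at u) \<and> 0 \<le> y"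
      using u \<open>u < 1\<close>
      by (intro exI[of _ "1 / (1 + u) + 1 / (1 - u) - 2"]) (auto intro!: derivative_eq_intros)
  qed
  then have "ln ((1 - s) / (1 + s)) \<le> - 2 * s"
    using assms by (simp add: ln_div)
  then show ?thesis
    using assms by (metis add_pos_nonneg diff_gt_0_iff_gt divide_pos_pos exp_le_cancel_iff exp_ln
        zero_less_one)
qed

text \<open>From 1/(1 - s) <= 1 + 2s for s <= 1/2. It controls the loss from reflecting a zero in
  the arc; with s = t/R and O(R) zeros, the total loss stays bounded.\<close>

lemma one_plus_div_one_minus_le_exp:
  assumes "0 \<le> s" "s \<le> (1/2::real)"
  shows "(1 + s) / (1 - s) \<le> exp (3 * s)"
proof -
  have "1 \<le> (1 - s) * (1 + 2 * s)"
    using assms mult_left_mono[of s "1/2" s] by (simp add: algebra_simps)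
  also have "\<dots> \<le> (1 - s) * exp (2 * s)"
    using assms by (intro mult_left_mono exp_ge_add_one_self) auto
  finally have "1 / (1 - s) \<le> exp (2 * s)"
    using assms by (simp add: field_simps)
  then have "(1 + s) * (1 / (1 - s)) \<le> exp s * exp (2 * s)"
    using assms by (intro mult_mono exp_ge_add_one_self) auto
  also have "\<dots> = exp (3 * s)" by (simp flip: exp_add)
  finally show ?thesis by simp
qed

text \<open>Telescoping with ln(1 + h) <= h, where h = 1/(n + \<kappa>).\<close>

lemma ln_le_sum_inverse_shift:
  assumes "\<kappa> > (0::real)"
  shows "ln ((real N + \<kappa>) / \<kappa>) \<le> (\<Sum>n<N. 1 / (real n + \<kappa>))"
proof (induction N)
  case (Suc N)
  have pos: "real N + \<kappa> > 0" using assms by simp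
  have "ln ((real (Suc N) + \<kappa>) / \<kappa>) = ln ((real N + \<kappa>) / \<kappa>) + ln (1 + 1 / (real N + \<kappa>))"
  proof -
    have "1 + 1 / (real N + \<kappa>) = (real (Suc N) + \<kappa>) / (real N + \<kappa>)"
      using pos by (simp add: field_simps)
    then have "(real (Suc N) + \<kappa>) / \<kappa> = (real N + \<kappa>) / \<kappa> * (1 + 1 / (real N + \<kappa>))"
      using pos by simp
    then show ?thesis
      using assms pos by (simp only: ln_mult_pos divide_pos_pos add_pos_pos zero_less_one)
  qed
  also have "\<dots> \<le> (\<Sum>n<N. 1 / (real n + \<kappa>)) + 1 / (real N + \<kappa>)"
    using pos by (intro add_mono Suc.IH ln_add_one_self_le_self) auto
  finally show ?case by simp
qed (use assms in simp)

text \<open>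
  As \<open>R\<close> grows, the majorant allows \<open>ln \<bar>F t\<bar>\<close> to grow like \<open>(2/\<pi>) \<tau> t ln R\<close>, whereas the Blaschke factors
  of the zeros below \<open>R\<close> contribute \<open>- 2 t D ln R\<close>.
\<close>

lemma carlson_uniqueness:
  fixes F :: "complex \<Rightarrow> complex" and a :: "nat \<Rightarrow> real"
  assumes hol: "F holomorphic_on UNIV"
    and bound: "\<And>z. cmod (F z) \<le> C * exp (\<tau> * cmod z)" and "\<tau> \<ge> 0"
    and zeros: "\<And>N. \<exists>G. G holomorphic_on UNIV \<and> (\<forall>z. F z = (\<Prod>n<N. z - of_real (a n)) * G z)"
    and a_lower: "\<And>n. a n \<ge> \<rho>" and \<rho>: "\<rho> > 0"
    and a_upper: "\<And>n. a n \<le> real n / D + K"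
    and D: "D > \<tau> / pi"
  shows "F z = 0"
proof -
  have "D > 0" using D \<open>\<tau> \<ge> 0\<close> by (smt (verit) divide_nonneg_pos pi_gt_zero)
  have K: "K > 0" using a_lower[of 0] a_upper[of 0] \<rho> by simp
  \<comment> \<open>To the left of all zeros every factor (a - t)/(a + t) is below 1. Vanishing on
    this interval is enough, by the identity theorem.\<close>
  have zero: "F (of_real t) = 0" if t: "0 < t" "t < \<rho>" for t
  proof -
    \<comment> \<open>By \<open>a_upper\<close> the first \<open>N\<close> zeros lie strictly below
      this radius. \<open>c\<close> gathers everything independent of \<open>N\<close>; the
      coefficient of ln R is 2 t \<tau> / pi from the majorant minus 2 t D from the zeros, that is,
      \<open>- B\<close>.\<close>
    define R where "R N = real N / D + K" for N
    define c where "c = C * exp (\<tau> * (2 * t - 2 / pi * t * ln t) + 3 * t * D + 2 * t * D * ln K)"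
    define B where "B = 2 * t * (D - \<tau> / pi)"
    have "B > 0" using t D by (simp add: B_def)
    have "C \<ge> 0" using bound[of 0] norm_ge_zero[of "F 0"] by (simp del: norm_ge_zero)
    have F_le: "cmod (F (of_real t)) \<le> c * exp (- B * ln (R N))" if N: "R N \<ge> 2 * t" for N
    proof -
      have R: "R N > 0" using N t by simp
      have a: "0 < a n \<and> a n < R N" if "n < N" for n
      proof -
        have "real n / D < real N / D"
          using that \<open>D > 0\<close> by (simp add: divide_strict_right_mono)
        then show ?thesis
          using a_lower[of n] a_upper[of n] \<rho> by (simp add: R_def)
      qed
      from zeros[of N] obtain G where G: "G holomorphic_on UNIV"
        "\<And>z. F z = (\<Prod>n<N. z - of_real (a n)) * G z" by blast
      have "cmod (F (of_real t)) \<le> C * exp (\<tau> * (2 * t + 2 / pi * t * (ln (R N) - ln t))) *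
          (\<Prod>n<N. \<bar>t - a n\<bar> / (t + a n) * (((R N)\<^sup>2 + a n * t) / ((R N)\<^sup>2 - a n * t)))"
        by (rule half_disc_bound[OF G(1) _ G(2) bound]) (use N t a \<open>\<tau> \<ge> 0\<close> in auto)
      also have "(\<Prod>n<N. \<bar>t - a n\<bar> / (t + a n) * (((R N)\<^sup>2 + a n * t) / ((R N)\<^sup>2 - a n * t)))
          \<le> (\<Prod>n<N. exp (- 2 * t * D * (1 / (real n + D * K))) * exp (3 * t / R N))"
      proof (intro prod_mono conjI mult_mono)
        fix n assume "n \<in> {..<N}"
        then have an: "0 < a n" "a n < R N" using a by auto
        have ta: "t < a n" using a_lower[of n] t by simp
        define s where "s = t / a n"
        have s: "0 \<le> s" "s < 1" using t ta an by (auto simp: s_def)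
        have "\<bar>t - a n\<bar> / (t + a n) = (1 - s) / (1 + s)"
        proof -
          have "\<bar>t - a n\<bar> = a n * (1 - s)" "t + a n = a n * (1 + s)"
            using an ta by (simp_all add: s_def field_simps)
          then show ?thesis using an by simp
        qed
        also have "\<dots> \<le> exp (- 2 * s)"
          by (rule one_minus_div_one_plus_le_exp[OF s])
        also have "t / (real n / D + K) \<le> s"
          unfolding s_def using an t a_upper[of n] by (intro divide_left_mono) (auto intro!: mult_pos_pos)
        then have "exp (- 2 * s) \<le> exp (- 2 * (t / (real n / D + K)))" by simp
        also have "real n / D + K = (real n + D * K) / D"
          using \<open>D > 0\<close> by (simp add: field_simps)
        then have "t / (real n / D + K) = t * D * (1 / (real n + D * K))"
          by simp
        finally show "\<bar>t - a n\<bar> / (t + a n) \<le> exp (- 2 * t * D * (1 / (real n + D * K)))"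
          by (simp add: mult_ac)
        define u where "u = t / R N"
        have u: "0 \<le> u" "u \<le> 1 / 2" using t N R by (auto simp: u_def field_simps)
        have "a n * t \<le> R N * t" using an t by (intro mult_right_mono) auto
        also have "R N * t = (R N)\<^sup>2 * u" using R by (simp add: u_def power2_eq_square)
        finally have le: "a n * t \<le> (R N)\<^sup>2 * u" .
        have pos: "0 < (R N)\<^sup>2 * (1 - u)" using R u by auto
        have "((R N)\<^sup>2 + a n * t) / ((R N)\<^sup>2 - a n * t) \<le>
            ((R N)\<^sup>2 * (1 + u)) / ((R N)\<^sup>2 * (1 - u))"
          using le pos an t u
          by (intro frac_le) (auto simp: algebra_simps intro!: add_nonneg_nonneg mult_nonneg_nonneg)
        also have "\<dots> = (1 + u) / (1 - u)" using R by simp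
        also have "\<dots> \<le> exp (3 * u)" by (rule one_plus_div_one_minus_le_exp[OF u])
        finally show "((R N)\<^sup>2 + a n * t) / ((R N)\<^sup>2 - a n * t) \<le> exp (3 * t / R N)"
          by (simp add: u_def)
        have "(R N)\<^sup>2 - a n * t \<ge> 0" using le pos by (simp add: algebra_simps)
        then show ge: "((R N)\<^sup>2 + a n * t) / ((R N)\<^sup>2 - a n * t) \<ge> 0"
          using an t by (intro divide_nonneg_nonneg) auto
        then show "0 \<le> \<bar>t - a n\<bar> / (t + a n) * (((R N)\<^sup>2 + a n * t) / ((R N)\<^sup>2 - a n * t))"
          using an t by (intro mult_nonneg_nonneg) auto
      qed auto
      also have "\<dots> = exp (- 2 * t * D * (\<Sum>n<N. 1 / (real n + D * K)) + real N * (3 * t / R N))"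
        by (simp add: prod.distrib exp_sum[symmetric] exp_add sum_distrib_left flip: exp_of_nat_mult)
      \<comment> \<open>The gains add up to a logarithm, while the \<open>N\<close> losses 3t/R
        remain bounded because N <= D R.\<close>
      also have "\<dots> \<le> exp (- 2 * t * D * (ln (R N) - ln K) + 3 * t * D)"
      proof -
        have "R N / K = (real N + D * K) / (D * K)"
          using K \<open>D > 0\<close> by (simp add: R_def field_simps)
        then have "ln (R N) - ln K = ln ((real N + D * K) / (D * K))"
          using R K ln_div[of "R N" K] by simp
        also have "\<dots> \<le> (\<Sum>n<N. 1 / (real n + D * K))"
          using K \<open>D > 0\<close> by (intro ln_le_sum_inverse_shift) auto
        finally have "2 * t * D * (ln (R N) - ln K) \<le> 2 * t * D * (\<Sum>n<N. 1 / (real n + D * K))"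
          using t \<open>D > 0\<close> by (intro mult_left_mono) auto
        moreover have "real N \<le> D * R N" using K \<open>D > 0\<close> by (simp add: R_def field_simps)
        then have "real N / R N \<le> D" using R by (simp add: field_simps)
        then have "3 * t * (real N / R N) \<le> 3 * t * D"
          using t by (intro mult_left_mono) auto
        moreover have "real N * (3 * t / R N) = 3 * t * (real N / R N)" by simp
        ultimately show ?thesis unfolding exp_le_cancel_iff by linarith
      qed
      finally have "cmod (F (of_real t)) \<le> C * exp (\<tau> * (2 * t + 2 / pi * t * (ln (R N) - ln t))) *
          exp (- 2 * t * D * (ln (R N) - ln K) + 3 * t * D)"
        using \<open>C \<ge> 0\<close> by (simp add: mult_left_mono)
      also have "\<dots> = c * exp (- B * ln (R N))"
        by (simp add: c_def B_def algebra_simps diff_divide_distrib flip: exp_add)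
      finally show ?thesis .
    qed
    have "(\<lambda>N. c * exp (- B * ln (real N / D + K))) \<longlonglongrightarrow> 0"
      using \<open>B > 0\<close> \<open>D > 0\<close> by real_asymp
    moreover have "eventually (\<lambda>N. real N / D + K \<ge> 2 * t) sequentially"
      using \<open>D > 0\<close> by real_asymp
    then have "eventually (\<lambda>N. cmod (F (of_real t)) \<le> c * exp (- B * ln (real N / D + K))) sequentially"
      by eventually_elim (use F_le in \<open>simp add: R_def\<close>)
    ultimately have "cmod (F (of_real t)) \<le> 0"
      by (intro tendsto_lowerbound[of _ 0 sequentially]) auto
    then show ?thesis by simp
  qed
  have "(of_real (\<rho> / 2) :: complex) islimpt (of_real ` {0<..<\<rho>})"
    unfolding islimpt_approachable
  proof safe
    fix e :: real assume "e > 0"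
    define h where "h = min (e / 2) (\<rho> / 4)"
    have "h > 0" "h < e" "h < \<rho> / 2" using \<open>e > 0\<close> \<rho> by (auto simp: h_def)
    moreover have "dist (complex_of_real (\<rho> / 2 + h)) (of_real (\<rho> / 2)) = \<bar>h\<bar>"
      by (simp only: dist_of_real) (simp add: dist_real_def)
    moreover have "complex_of_real (\<rho> / 2 + h) \<noteq> of_real (\<rho> / 2)"
      using \<open>h > 0\<close> by (simp only: of_real_eq_iff)
    moreover have "complex_of_real (\<rho> / 2 + h) \<in> of_real ` {0<..<\<rho>}"
      by (rule imageI) (use \<open>h > 0\<close> \<open>h < \<rho> / 2\<close> in simp)
    ultimately show "\<exists>x'\<in>complex_of_real ` {0<..<\<rho>}. x' \<noteq> of_real (\<rho> / 2) \<and> dist x' (of_real (\<rho> / 2)) < e"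
      by (metis abs_of_pos)
  qed
  then show ?thesis
    by (intro analytic_continuation[OF hol open_UNIV connected_UNIV, of "of_real ` {0<..<\<rho>}" "of_real (\<rho>/2)" z])
      (use zero in auto)
qed

section \<open>Canonical products close to a sine\<close>

lemma sum_inverse_one_plus_abs_le_harm:
  "(\<Sum>j\<in>{- int Q..int Q}. 1 / (1 + real_of_int \<bar>j\<bar>)) \<le> 2 * harm (Suc Q)"
proof (induction Q)
  case 0
  then show ?case by (simp add: harm_def)
next
  case (Suc Q)
  have "{- int (Suc Q)..int (Suc Q)} = insert (int (Suc Q)) (insert (- int (Suc Q)) {- int Q..int Q})"
    by auto
  then have "(\<Sum>j\<in>{- int (Suc Q)..int (Suc Q)}. 1 / (1 + real_of_int \<bar>j\<bar>)) =
      2 / (2 + real Q) + (\<Sum>j\<in>{- int Q..int Q}. 1 / (1 + real_of_int \<bar>j\<bar>))"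
    by (simp add: abs_if)
  also have "\<dots> \<le> 2 / (2 + real Q) + 2 * harm (Suc Q)"
    using Suc.IH by simp
  also have "\<dots> = 2 * harm (Suc (Suc Q))"
    by (simp add: harm_Suc[of "Suc Q"] field_simps)
  finally show ?case .
qed

lemma harm_le_one_plus_ln:
  assumes "n > 0"
  shows "harm n \<le> 1 + ln (real n)"
proof -
  obtain m where m: "n = Suc m" using assms by (cases n) auto
  have "harm (Suc m) - ln (real (Suc m)) \<le> harm (Suc 0) - ln (real (Suc 0))"
    using decseq_harm_diff_ln by (rule decseqD) simp
  then show ?thesis by (simp add: m harm_def)
qed

text \<open>Telescoping with 1/(n+1)^2 <= 1/n - 1/(n+1).\<close>

lemma sum_inverse_squares_tail_le:
  assumes "T > 0"
  shows "(\<Sum>n=Suc T..N. 1 / (real n)\<^sup>2) \<le> 1 / real T"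
proof (cases "T \<le> N")
  case True
  then have "(\<Sum>n=Suc T..N. 1 / (real n)\<^sup>2) \<le> 1 / real T - 1 / real N"
  proof (induction N rule: dec_induct)
    case (step N)
    have "1 / (real (Suc N))\<^sup>2 \<le> 1 / (real N * real (Suc N))"
      using step assms by (intro divide_left_mono) (auto simp: power2_eq_square intro: mult_right_mono)
    also have "\<dots> = 1 / real N - 1 / real (Suc N)"
      using step assms by (simp add: field_simps)
    finally show ?case
      using step by (simp add: sum.atLeast_Suc_atMost_Suc_shift)
  qed simp
  also have "\<dots> \<le> 1 / real T" by simp
  finally show ?thesis .
qed simp

text \<open>The summand measures the effect of moving the n-th zero of the sine by a bounded amount.
  Up to about 2|z| it is at most 1/n + 1/|n - z|, two harmonic sums; beyond, it is at most 2|z|/n^2,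
  with bounded sum. The total is logarithmic, which is why the canonical product loses only a power
  of |z|.\<close>

lemma sum_interpolation_kernel_le:
  fixes z :: complex
  assumes z: "\<And>j::int. cmod (z - of_int j) \<ge> 1 / 2"
  shows "(\<Sum>n=1..N. cmod z / (real n * cmod (of_nat n - z))) \<le> 28 + 9 * ln (2 + cmod z)"
proof -
  define r where "r = cmod z"
  define T where "T = nat \<lceil>2 * r\<rceil>"
  define m where "m = round (Re z)"
  \<comment> \<open>Large enough for the window {1..T}, recentred at the integer \<open>m\<close>
    nearest to Re z, to fit into [-Q, Q].\<close>
  define Q where "Q = T + nat \<bar>m\<bar>"
  have r: "r \<ge> 1 / 2" using z[of 0] by (simp add: r_def)
  have T: "real T \<ge> 2 * r" "real T \<le> 2 * r + 1" using r unfolding T_def by linarith+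
  have T0: "T > 0" using T r by linarith
  have m: "\<bar>of_int m - Re z\<bar> \<le> 1 / 2" unfolding m_def by (rule of_int_round_abs_le)
  have zn: "cmod (of_nat n - z) \<ge> 1 / 2" for n
    using z[of "int n"] by (simp add: norm_minus_commute)
  have small: "r / (real n * cmod (of_nat n - z)) \<le>
      inverse (real n) + 4 * (1 / (1 + real_of_int \<bar>int n - m\<bar>))" if "n \<ge> 1" for n
  proof -
    let ?d = "cmod (of_nat n - z)"
    have d: "?d > 0" using zn[of n] by linarith
    have "r \<le> real n + ?d"
      using norm_triangle_ineq2[of z "of_nat n"] by (simp add: r_def norm_minus_commute)
    then have "r / (real n * ?d) \<le> (real n + ?d) / (real n * ?d)"
      by (intro divide_right_mono) auto
    also have "\<dots> = inverse (real n) + 1 / ?d"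
      using d that by (simp add: field_simps)
    also have "1 / ?d \<le> 4 * (1 / (1 + real_of_int \<bar>int n - m\<bar>))"
    proof -
      \<comment> \<open>For n different from m, |n - m| <= d + 1/2, and d >= 1/2 gives 1 + |n - m|
        <= d + 3/2 <= 4d.\<close>
      have "1 + real_of_int \<bar>int n - m\<bar> \<le> 4 * ?d"
      proof (cases "int n = m")
        case False
        then have "real_of_int \<bar>int n - m\<bar> \<ge> 1" by linarith
        moreover have "\<bar>real n - Re z\<bar> \<le> ?d"
          using abs_Re_le_cmod[of "of_nat n - z"] by simp
        moreover have "real_of_int \<bar>int n - m\<bar> = \<bar>real n - real_of_int m\<bar>" by simp
        ultimately show ?thesis using m by linarith
      qed (use zn[of n] in auto)
      then show ?thesis using d by (simp add: field_simps)
    qed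
    finally show ?thesis by simp
  qed
  have large: "r / (real n * cmod (of_nat n - z)) \<le> 2 * r * (1 / (real n)\<^sup>2)" if "n \<ge> Suc T" for n
  proof -
    have n: "real n > 2 * r" "real n > 0" using that T r by linarith+
    have "real n - r \<le> cmod (of_nat n - z)"
      using norm_triangle_ineq2[of "of_nat n" z] by (simp add: r_def)
    then have "real n / 2 \<le> cmod (of_nat n - z)" using n by linarith
    moreover from this have "0 < real n * cmod (of_nat n - z) * (real n * (real n / 2))"
      using n by (intro mult_pos_pos) linarith+
    ultimately have "r / (real n * cmod (of_nat n - z)) \<le> r / (real n * (real n / 2))"
      using r by (intro divide_left_mono mult_left_mono) auto
    then show ?thesis by (simp add: power2_eq_square mult.commute)
  qed
  have "(\<Sum>n=1..N. r / (real n * cmod (of_nat n - z))) \<le>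
      (\<Sum>n\<in>{1..T} \<union> {Suc T..N}. r / (real n * cmod (of_nat n - z)))"
    using r by (intro sum_mono2) auto
  also have "\<dots> = (\<Sum>n=1..T. r / (real n * cmod (of_nat n - z))) +
      (\<Sum>n=Suc T..N. r / (real n * cmod (of_nat n - z)))"
    by (intro sum.union_disjoint) auto
  also have "\<dots> \<le> (\<Sum>n=1..T. inverse (real n) + 4 * (1 / (1 + real_of_int \<bar>int n - m\<bar>))) +
      (\<Sum>n=Suc T..N. 2 * r * (1 / (real n)\<^sup>2))"
    using small large by (intro add_mono sum_mono) auto
  also have "\<dots> = harm T + 4 * (\<Sum>n=1..T. 1 / (1 + real_of_int \<bar>int n - m\<bar>)) +
      2 * r * (\<Sum>n=Suc T..N. 1 / (real n)\<^sup>2)"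
    by (simp add: sum.distrib sum_distrib_left harm_def)
  also have "(\<Sum>n=1..T. 1 / (1 + real_of_int \<bar>int n - m\<bar>)) =
      (\<Sum>j\<in>(\<lambda>n. int n - m) ` {1..T}. 1 / (1 + real_of_int \<bar>j\<bar>))"
    by (subst sum.reindex) (auto simp: inj_on_def)
  also have "\<dots> \<le> (\<Sum>j\<in>{- int Q..int Q}. 1 / (1 + real_of_int \<bar>j\<bar>))"
    by (intro sum_mono2) (auto simp: Q_def)
  also have "\<dots> \<le> 2 * harm (Suc Q)"
    by (rule sum_inverse_one_plus_abs_le_harm)
  also have "harm T \<le> (harm (Suc Q) :: real)"
    by (intro harm_mono) (simp add: Q_def)
  also have "2 * r * (\<Sum>n=Suc T..N. 1 / (real n)\<^sup>2) \<le> 2 * r * (1 / real T)"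
    using r by (intro mult_left_mono sum_inverse_squares_tail_le T0) auto
  also have "2 * r * (1 / real T) \<le> 1"
    using T T0 by (simp add: field_simps)
  \<comment> \<open>With harm <= 1 + ln 3 + ln(2 + r) and ln 3 <= 2 this yields 1 + 9 * 3 = 28 and
    the coefficient 9.\<close>
  also have "harm (Suc Q) + 4 * (2 * harm (Suc Q)) + 1 = 1 + 9 * (harm (Suc Q) :: real)"
    by simp
  also have "harm (Suc Q) \<le> 1 + ln (real (Suc Q))"
    by (rule harm_le_one_plus_ln) simp
  also have "ln (real (Suc Q)) \<le> ln (3 * (2 + r))"
  proof -
    have "\<bar>Re z\<bar> \<le> r" unfolding r_def by (rule abs_Re_le_cmod)
    then have "real_of_int \<bar>m\<bar> \<le> r + 1 / 2" using m by linarith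
    moreover have "real (nat \<bar>m\<bar>) = real_of_int \<bar>m\<bar>" by simp
    ultimately have "real (Suc Q) \<le> 3 * (2 + r)"
      using T by (simp add: Q_def)
    then show ?thesis by (subst ln_le_cancel_iff) auto
  qed
  also have "\<dots> = ln 3 + ln (2 + r)"
    using r by (subst ln_mult_pos) auto
  also have "ln 3 \<le> (2::real)" using ln_le_minus_one[of "3::real"] by simp
  finally show ?thesis by (simp add: r_def)
qed

text \<open>
  Comparison of a factor of the canonical product with the corresponding factor of the sine
  product, via \<open>1 - z/y = (1 - z/n) (1 + (y - n) z / (y (n - z)))\<close>.
\<close>

lemma norm_one_minus_divide_le:
  fixes z :: complex and y L c :: real
  assumes y: "\<bar>y - real n\<bar> \<le> L" "\<bar>y\<bar> \<ge> c * real n" and "c > 0" "n > 0" and z: "z \<noteq> of_nat n"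
  shows "cmod (1 - z / of_real y) \<le>
    cmod (1 - z / of_nat n) * exp (L / c * (cmod z / (real n * cmod (of_nat n - z))))"
proof -
  have y0: "y \<noteq> 0" "\<bar>y\<bar> > 0" using y(2) \<open>c > 0\<close> \<open>n > 0\<close> by (auto simp: mult_le_0_iff)
  define w where "w = of_real (y - real n) * z / (of_real y * (of_nat n - z))"
  have "1 - z / of_real y = (1 - z / of_nat n) * (1 + w)"
    using y0 z \<open>n > 0\<close> by (simp add: w_def divide_simps) (simp add: algebra_simps)
  moreover have "cmod (1 + w) \<le> exp (L / c * (cmod z / (real n * cmod (of_nat n - z))))"
  proof -
    have "cmod w = \<bar>y - real n\<bar> * cmod z / (\<bar>y\<bar> * cmod (of_nat n - z))"
      unfolding w_def norm_mult norm_divide by (simp only: norm_of_real)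
    also have "\<dots> \<le> L * cmod z / (c * real n * cmod (of_nat n - z))"
      using y \<open>c > 0\<close> \<open>n > 0\<close> z by (intro frac_le mult_right_mono mult_pos_pos) auto
    finally have "cmod w \<le> L / c * (cmod z / (real n * cmod (of_nat n - z)))" by simp
    moreover have "cmod (1 + w) \<le> 1 + cmod w"
      using norm_triangle_ineq[of 1 w] by simp
    ultimately show ?thesis
      using exp_ge_add_one_self[of "L / c * (cmod z / (real n * cmod (of_nat n - z)))"] by linarith
  qed
  ultimately show ?thesis
    by (simp add: norm_mult mult_left_mono)
qed

text \<open>Pairing the indices k and -k, as in Euler's product for the sine, makes the product
  converge, because y(k) + y(-k) is bounded. Away from the integers it is compared with the sine
  factor by factor.\<close>

lemma canonical_product_exists:
  fixes y :: "int \<Rightarrow> real"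
  assumes y0: "y 0 = 0" and near: "\<And>k. \<bar>y k - of_int k\<bar> \<le> L"
    and lower: "\<And>k. c * \<bar>of_int k\<bar> \<le> \<bar>y k\<bar>" and c: "c > 0"
  obtains P C M where "P holomorphic_on UNIV" "real_on_reals P"
    "\<And>z. P z = 0 \<longleftrightarrow> z \<in> range (\<lambda>k. complex_of_real (y k))"
    "\<And>z. cmod (P z) \<le> C * (3 + cmod z) ^ M * exp (pi * \<bar>Im z\<bar>)"
proof -
  define F where "F n z = (1 - z / of_real (y (int (Suc n)))) * (1 - z / of_real (y (- int (Suc n))))"
    for n and z :: complex
  define g where "g z = lim (\<lambda>N. \<Prod>n<N. F n z)" for z
  define P where "P z = z * g z" for z
  have L: "L \<ge> 0" using near[of 0] by simp
  have y_nz: "y k \<noteq> 0" if "k \<noteq> 0" for k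
    using lower[of k] c that by (auto simp: mult_le_0_iff)
  have F_minus_1: "cmod (F n z - 1) \<le> (2 * L * cmod z + (cmod z)\<^sup>2) / c\<^sup>2 * (1 / (real (Suc n))\<^sup>2)" for n z
  proof -
    let ?k = "int (Suc n)"
    define u v where "u = y ?k" and "v = y (- ?k)"
    have uv: "u \<noteq> 0" "v \<noteq> 0" using y_nz[of ?k] y_nz[of "- ?k"] by (auto simp: u_def v_def)
    have "c * real (Suc n) \<le> \<bar>u\<bar>" "c * real (Suc n) \<le> \<bar>v\<bar>"
      using lower[of ?k] lower[of "- ?k"] by (simp_all add: u_def v_def algebra_simps)
    then have "(c * real (Suc n)) * (c * real (Suc n)) \<le> \<bar>u\<bar> * \<bar>v\<bar>"
      using c by (intro mult_mono) auto
    then have den: "c\<^sup>2 * (real (Suc n))\<^sup>2 \<le> \<bar>u\<bar> * \<bar>v\<bar>"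
      by (simp add: power2_eq_square mult_ac)
    have sum: "\<bar>u + v\<bar> \<le> 2 * L"
      using near[of ?k] near[of "- ?k"] by (simp add: u_def v_def)
    \<comment> \<open>Only the sum u + v enters the linear term, and there the parts n and -n
      cancel; hence a summable bound of order 1/n^2.\<close>
    have "F n z - 1 = (z\<^sup>2 - of_real (u + v) * z) / (of_real u * of_real v)"
      using uv unfolding F_def u_def[symmetric] v_def[symmetric]
      by (simp add: divide_simps) (simp add: algebra_simps power2_eq_square)
    then have "cmod (F n z - 1) = cmod (z\<^sup>2 - of_real (u + v) * z) / (\<bar>u\<bar> * \<bar>v\<bar>)"
      by (simp add: norm_divide norm_mult)
    also have "cmod (z\<^sup>2 - of_real (u + v) * z) \<le> cmod (z\<^sup>2) + cmod (of_real (u + v) * z)"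
      by (rule norm_triangle_ineq4)
    also have "\<dots> = (cmod z)\<^sup>2 + \<bar>u + v\<bar> * cmod z"
      unfolding norm_mult norm_power by (simp only: norm_of_real)
    also have "\<dots> \<le> 2 * L * cmod z + (cmod z)\<^sup>2"
      using mult_right_mono[OF sum, of "cmod z"] by simp
    finally have "cmod (F n z - 1) \<le> (2 * L * cmod z + (cmod z)\<^sup>2) / (\<bar>u\<bar> * \<bar>v\<bar>)"
      using uv by (simp add: divide_right_mono)
    also have "\<dots> \<le> (2 * L * cmod z + (cmod z)\<^sup>2) / (c\<^sup>2 * (real (Suc n))\<^sup>2)"
      using den L c uv by (intro divide_left_mono) auto
    finally show ?thesis by (simp add: mult_ac)
  qed
  have summable_sq: "summable (\<lambda>n. 1 / (real (Suc n))\<^sup>2)"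
    using inverse_squares_sums by (auto simp: sums_iff add_ac)
  have conv: "convergent_prod (\<lambda>n. F n z)" for z
  proof -
    have "summable (\<lambda>n. cmod (F n z - 1))"
      using F_minus_1[of _ z]
      by (intro summable_comparison_test'[OF summable_mult[OF summable_sq,
          of "(2 * L * cmod z + (cmod z)\<^sup>2) / c\<^sup>2"], of 0]) auto
    then show ?thesis
      by (intro abs_convergent_prod_imp_convergent_prod) (simp add: abs_convergent_prod_conv_summable)
  qed
  have lim_g: "(\<lambda>N. \<Prod>n<N. F n z) \<longlonglongrightarrow> g z" and g_prodinf: "g z = prodinf (\<lambda>n. F n z)" for z
  proof -
    have "(\<lambda>N. \<Prod>n<N. F n z) \<longlonglongrightarrow> prodinf (\<lambda>n. F n z)"
      using convergent_prod_LIMSEQ[OF conv[of z]]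
      unfolding lessThan_Suc_atMost[symmetric] by (rule LIMSEQ_imp_Suc)
    then show "g z = prodinf (\<lambda>n. F n z)" "(\<lambda>N. \<Prod>n<N. F n z) \<longlonglongrightarrow> g z"
      by (simp_all add: g_def limI)
  qed
  have hol_g: "g holomorphic_on UNIV"
  proof (rule holomorphic_uniform_sequence[of UNIV "\<lambda>N z. \<Prod>n<N. F n z"])
    show "(\<lambda>z. \<Prod>n<N. F n z) holomorphic_on UNIV" for N
      unfolding F_def using y_nz by (intro holomorphic_intros) auto
    fix x :: complex
    define r where "r = cmod x + 1"
    have le_r: "cmod z \<le> r" if "z \<in> cball x 1" for z
      using that norm_triangle_ineq2[of z x] by (simp add: r_def dist_norm norm_minus_commute)
    have "uniformly_convergent_on (cball x 1) (\<lambda>N z. \<Prod>n<N. F n z)"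
    proof (rule uniformly_convergent_on_prod')
      show "continuous_on (cball x 1) (F n)" for n
        unfolding F_def using y_nz by (intro continuous_intros) auto
      show "uniformly_convergent_on (cball x 1) (\<lambda>N z. \<Sum>n<N. norm (F n z - 1))"
      proof (rule Weierstrass_m_test')
        fix n z assume z: "z \<in> cball x 1"
        have "cmod (F n z - 1) \<le> (2 * L * cmod z + (cmod z)\<^sup>2) / c\<^sup>2 * (1 / (real (Suc n))\<^sup>2)"
          by (rule F_minus_1)
        also have "\<dots> \<le> (2 * L * r + r\<^sup>2) / c\<^sup>2 * (1 / (real (Suc n))\<^sup>2)"
          using le_r[OF z] L
          by (intro mult_right_mono divide_right_mono add_mono mult_left_mono power_mono) auto
        finally show "norm (norm (F n z - 1)) \<le> (2 * L * r + r\<^sup>2) / c\<^sup>2 * (1 / (real (Suc n))\<^sup>2)"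
          by simp
      qed (rule summable_mult[OF summable_sq])
    qed auto
    then have "uniform_limit (cball x 1) (\<lambda>N z. \<Prod>n<N. F n z) g sequentially"
      unfolding uniformly_convergent_uniform_limit_iff g_def .
    then show "\<exists>d>0. cball x d \<subseteq> UNIV \<and> uniform_limit (cball x d) (\<lambda>N z. \<Prod>n<N. F n z) g sequentially"
      by (intro exI[of _ 1]) auto
  qed auto
  have hol: "P holomorphic_on UNIV"
    unfolding P_def using hol_g by (intro holomorphic_intros)
  have real: "real_on_reals P"
    unfolding real_on_reals_def
  proof
    fix t :: real
    have "(\<Prod>n<N. F n (of_real t)) \<in> \<real>" for N
      unfolding F_def by (intro prod_in_Reals Reals_mult Reals_diff Reals_divide) auto
    then have "g (of_real t) \<in> \<real>"
      by (intro Lim_in_closed_set[OF closed_complex_Reals _ _ lim_g]) auto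
    then show "P (of_real t) \<in> \<real>" unfolding P_def by simp
  qed
  have zeros: "P z = 0 \<longleftrightarrow> z \<in> range (\<lambda>k. complex_of_real (y k))" for z
  proof
    assume "P z = 0"
    then consider "z = 0" | "g z = 0" by (auto simp: P_def)
    then show "z \<in> range (\<lambda>k. complex_of_real (y k))"
    proof cases
      case 1
      then show ?thesis using y0 by (auto simp: image_iff intro!: exI[of _ 0])
    next
      case 2
      then obtain n where "F n z = 0"
        using prodinf_nonzero[OF conv[of z]] by (auto simp: g_prodinf)
      then have "z = of_real (y (int (Suc n))) \<or> z = of_real (y (- int (Suc n)))"
        using y_nz by (auto simp: F_def)
      then show ?thesis by auto
    qed
  next
    assume "z \<in> range (\<lambda>k. complex_of_real (y k))"
    then obtain k where k: "z = of_real (y k)" by auto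
    show "P z = 0"
    proof (cases "k = 0")
      case True
      then show ?thesis using k y0 by (simp add: P_def)
    next
      case False
      define n where "n = nat (\<bar>k\<bar> - 1)"
      have "k = int (Suc n) \<or> k = - int (Suc n)" using False by (auto simp: n_def)
      then have "F n z = 0" using y_nz[OF False] by (auto simp: F_def k)
      then have "eventually (\<lambda>N. (\<Prod>n<N. F n z) = 0) sequentially"
        by (intro eventually_sequentiallyI[of "Suc n"]) auto
      then have "(\<lambda>N. \<Prod>n<N. F n z) \<longlonglongrightarrow> 0"
        by (rule tendsto_eventually)
      then have "g z = 0" using lim_g LIMSEQ_unique by blast
      then show ?thesis by (simp add: P_def)
    qed
  qed
  \<comment> \<open>A displaced factor costs at most the exponential of \<kappa> times the kernel.
    The kernel sums for z and -z together are at most 56 + 18 ln(2 + |z|), twice the bound for one;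
    hence the exponent \<open>M\<close>.\<close>
  define \<kappa> where "\<kappa> = L / c"
  define M where "M = nat \<lceil>18 * \<kappa>\<rceil>"
  have \<kappa>: "\<kappa> \<ge> 0" using L c by (simp add: \<kappa>_def)
  have good: "cmod (P z) \<le> exp (56 * \<kappa>) * (2 + cmod z) ^ M * exp (pi * \<bar>Im z\<bar>)"
    if z: "\<And>j::int. cmod (z - of_int j) \<ge> 1 / 2" for z
  proof -
    define A where "A w n = cmod w / (real n * cmod (of_nat n - w))" for w n
    define E where "E = exp (\<kappa> * (56 + 18 * ln (2 + cmod z)))"
    have zm: "cmod (- z - of_int j) \<ge> 1 / 2" for j
      using z[of "- j"] norm_minus_cancel[of "- z - of_int j"] by (simp add: add.commute)
    have nz: "z \<noteq> of_nat n" "- z \<noteq> of_nat n" for n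
      using z[of "int n"] zm[of "int n"] by auto
    have F_le: "cmod (F n z) \<le> cmod (1 - z\<^sup>2 / of_nat (Suc n) ^ 2) *
        exp (\<kappa> * (A z (Suc n) + A (- z) (Suc n)))" for n
    proof -
      let ?k = "int (Suc n)"
      have 1: "cmod (1 - z / of_real (y ?k)) \<le> cmod (1 - z / of_nat (Suc n)) * exp (\<kappa> * A z (Suc n))"
        unfolding A_def \<kappa>_def
        by (rule norm_one_minus_divide_le) (use near[of ?k] lower[of ?k] c nz(1)[of "Suc n"] in auto)
      \<comment> \<open>The negative index is reduced to the positive one by changing the signs of
        both z and the zero.\<close>
      have "cmod (1 - (- z) / of_real (- y (- ?k))) \<le>
          cmod (1 - (- z) / of_nat (Suc n)) * exp (\<kappa> * A (- z) (Suc n))"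
        unfolding A_def \<kappa>_def
        by (rule norm_one_minus_divide_le) (use near[of "- ?k"] lower[of "- ?k"] c nz(2)[of "Suc n"] in \<open>auto simp: algebra_simps\<close>)
      then have 2: "cmod (1 - z / of_real (y (- ?k))) \<le> cmod (1 + z / of_nat (Suc n)) * exp (\<kappa> * A (- z) (Suc n))"
        by simp
      have "cmod (F n z) \<le> (cmod (1 - z / of_nat (Suc n)) * exp (\<kappa> * A z (Suc n))) *
          (cmod (1 + z / of_nat (Suc n)) * exp (\<kappa> * A (- z) (Suc n)))"
        unfolding F_def norm_mult by (intro mult_mono 1 2) auto
      also have "\<dots> = cmod ((1 - z / of_nat (Suc n)) * (1 + z / of_nat (Suc n))) *
          exp (\<kappa> * (A z (Suc n) + A (- z) (Suc n)))"
      proof -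
        have "exp (\<kappa> * (A z (Suc n) + A (- z) (Suc n))) = exp (\<kappa> * A z (Suc n)) * exp (\<kappa> * A (- z) (Suc n))"
          by (simp only: distrib_left exp_add)
        then show ?thesis by (simp only: norm_mult mult_ac)
      qed
      also have "(1 - z / of_nat (Suc n)) * (1 + z / of_nat (Suc n)) = 1 - z\<^sup>2 / of_nat (Suc n) ^ 2"
        by (simp add: algebra_simps power2_eq_square del: of_nat_Suc)
      finally show ?thesis .
    qed
    have P_N: "cmod (z * (\<Prod>n<N. F n z)) \<le>
        cmod (of_real pi * z * (\<Prod>k=1..N. 1 - z\<^sup>2 / of_nat k ^ 2)) * E" for N
    proof -
      have "cmod (\<Prod>n<N. F n z) \<le> (\<Prod>n<N. cmod (1 - z\<^sup>2 / of_nat (Suc n) ^ 2) *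
          exp (\<kappa> * (A z (Suc n) + A (- z) (Suc n))))"
        unfolding prod_norm[symmetric] by (intro prod_mono conjI norm_ge_zero F_le)
      also have "\<dots> = cmod (\<Prod>n<N. 1 - z\<^sup>2 / of_nat (Suc n) ^ 2) *
          exp (\<kappa> * ((\<Sum>n<N. A z (Suc n)) + (\<Sum>n<N. A (- z) (Suc n))))"
        by (simp only: prod.distrib prod_norm exp_sum[OF finite_lessThan, symmetric]
            sum_distrib_left[symmetric] sum.distrib)
      also have "(\<Prod>n<N. 1 - z\<^sup>2 / of_nat (Suc n) ^ 2) = (\<Prod>k=1..N. 1 - z\<^sup>2 / of_nat k ^ 2)"
        by (rule prod.reindex_bij_witness[of _ "\<lambda>k. k - 1" Suc]) auto
      also have "exp (\<kappa> * ((\<Sum>n<N. A z (Suc n)) + (\<Sum>n<N. A (- z) (Suc n)))) \<le> E"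
      proof -
        have reindex: "(\<Sum>n<N. A w (Suc n)) = (\<Sum>k=1..N. A w k)" for w
          by (rule sum.reindex_bij_witness[of _ "\<lambda>k. k - 1" Suc]) auto
        have "(\<Sum>n<N. A z (Suc n)) + (\<Sum>n<N. A (- z) (Suc n)) \<le> 56 + 18 * ln (2 + cmod z)"
          unfolding reindex
          using sum_interpolation_kernel_le[OF z, of N] sum_interpolation_kernel_le[OF zm, of N]
          unfolding A_def by simp
        then show ?thesis using \<kappa> by (simp add: E_def mult_left_mono)
      qed
      finally have "cmod (\<Prod>n<N. F n z) \<le> cmod (\<Prod>k=1..N. 1 - z\<^sup>2 / of_nat k ^ 2) * E"
        by (simp add: mult_left_mono)
      \<comment> \<open>The extra factor pi >= 1 completes the partial product of sin(pi z).\<close>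
      then have "cmod z * cmod (\<Prod>n<N. F n z) \<le>
          pi * cmod z * (cmod (\<Prod>k=1..N. 1 - z\<^sup>2 / of_nat k ^ 2) * E)"
        using pi_ge_two by (intro mult_mono mult_right_mono[of 1 pi "cmod z", simplified]) (auto simp: E_def)
      then show ?thesis by (simp add: norm_mult mult_ac)
    qed
    have "cmod (P z) \<le> cmod (sin (of_real pi * z)) * E"
    proof (rule LIMSEQ_le)
      show "(\<lambda>N. cmod (z * (\<Prod>n<N. F n z))) \<longlonglongrightarrow> cmod (P z)"
        unfolding P_def by (intro tendsto_intros lim_g)
      show "(\<lambda>N. cmod (of_real pi * z * (\<Prod>k=1..N. 1 - z\<^sup>2 / of_nat k ^ 2)) * E)
          \<longlonglongrightarrow> cmod (sin (of_real pi * z)) * E"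
        by (intro tendsto_intros sin_product_formula_complex)
    qed (use P_N in blast)
    moreover have "cmod (sin (of_real pi * z)) \<le> exp (pi * \<bar>Im z\<bar>)"
      using cmod_sin_le_exp[of 1 "of_real pi * z"] by (simp add: abs_mult)
    moreover have "E \<le> exp (56 * \<kappa>) * (2 + cmod z) ^ M"
    proof -
      have "18 * \<kappa> \<le> real M" unfolding M_def by linarith
      then have "18 * \<kappa> * ln (2 + cmod z) \<le> real M * ln (2 + cmod z)"
        by (intro mult_right_mono ln_ge_zero) (auto simp: add_increasing2)
      then have "E \<le> exp (56 * \<kappa> + real M * ln (2 + cmod z))"
        by (simp add: E_def algebra_simps)
      also have "\<dots> = exp (56 * \<kappa>) * (2 + cmod z) ^ M"
        by (simp add: exp_add exp_of_nat_mult add_pos_nonneg)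
      finally show ?thesis .
    qed
    ultimately have "cmod (P z) \<le> exp (pi * \<bar>Im z\<bar>) * (exp (56 * \<kappa>) * (2 + cmod z) ^ M)"
      by (elim order_trans) (intro mult_mono, auto simp: E_def)
    then show ?thesis by (simp only: mult_ac)
  qed
  \<comment> \<open>near an integer, the maximum principle on the disc of radius 1/2 gives the same bound\<close>
  have bound: "cmod (P z) \<le> (exp (56 * \<kappa>) * exp pi) * (3 + cmod z) ^ M * exp (pi * \<bar>Im z\<bar>)" for z
  proof -
    \<comment> \<open>Passing from w to z at distance at most 1 replaces 2 by 3 and costs the factor
      exp pi.\<close>
    have w_bound: "cmod (P w) \<le> (exp (56 * \<kappa>) * exp pi) * (3 + cmod z) ^ M * exp (pi * \<bar>Im z\<bar>)"
      if w: "\<And>j::int. cmod (w - of_int j) \<ge> 1 / 2" and wz: "cmod (w - z) \<le> 1" for w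
    proof -
      have "cmod w \<le> cmod z + 1" using norm_triangle_ineq2[of w z] wz by simp
      then have 1: "(2 + cmod w) ^ M \<le> (3 + cmod z) ^ M" by (intro power_mono) auto
      have "\<bar>Im w\<bar> \<le> \<bar>Im z\<bar> + 1" using abs_Im_le_cmod[of "w - z"] wz by simp
      then have "pi * \<bar>Im w\<bar> \<le> pi * (\<bar>Im z\<bar> + 1)" by (intro mult_left_mono) auto
      then have 2: "exp (pi * \<bar>Im w\<bar>) \<le> exp pi * exp (pi * \<bar>Im z\<bar>)"
        by (simp add: distrib_left flip: exp_add)
      have "exp (56 * \<kappa>) * (2 + cmod w) ^ M * exp (pi * \<bar>Im w\<bar>) \<le>
          exp (56 * \<kappa>) * (3 + cmod z) ^ M * (exp pi * exp (pi * \<bar>Im z\<bar>))"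
        by (intro mult_mono 1 2) auto
      from order_trans[OF good[OF w] this] show ?thesis by (simp only: mult_ac)
    qed
    show ?thesis
    proof (cases "\<forall>j::int. cmod (z - of_int j) \<ge> 1 / 2")
      case True
      then show ?thesis by (intro w_bound) auto
    next
      case False
      then obtain j :: int where j: "cmod (z - of_int j) < 1 / 2" by (auto simp: not_le)
      show ?thesis
      proof (rule maximum_modulus_frontier[of P "cball (of_int j) (1/2)"])
        show "z \<in> cball (of_int j) (1 / 2)" using j by (simp add: dist_norm norm_minus_commute)
        show "P holomorphic_on interior (cball (of_int j) (1 / 2))"
          using hol holomorphic_on_subset by blast
        show "continuous_on (closure (cball (of_int j) (1 / 2))) P"
          using hol holomorphic_on_imp_continuous_on continuous_on_subset by blast
        fix w :: complex assume "w \<in> frontier (cball (of_int j) (1 / 2))"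
        then have wj: "cmod (w - of_int j) = 1 / 2"
          by (simp add: frontier_cball dist_norm norm_minus_commute)
        show "cmod (P w) \<le> (exp (56 * \<kappa>) * exp pi) * (3 + cmod z) ^ M * exp (pi * \<bar>Im z\<bar>)"
        proof (rule w_bound)
          fix i :: int
          show "cmod (w - of_int i) \<ge> 1 / 2"
          proof (cases "i = j")
            case False
            then have "1 \<le> \<bar>real_of_int (j - i)\<bar>" by linarith
            also have "\<dots> = cmod (of_int (j - i))" by (simp only: norm_of_int)
            also have "\<dots> \<le> cmod (w - of_int i) + cmod (w - of_int j)"
              using norm_triangle_ineq4[of "w - of_int i" "w - of_int j"] by simp
            finally show ?thesis using wj by simp
          qed (use wj in simp)
          show "cmod (w - z) \<le> 1"
            using norm_triangle_ineq4[of "w - of_int j" "z - of_int j"] wj j by simp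
        qed
      qed simp
    qed
  qed
  show thesis
    by (rule that[OF hol real zeros bound])
qed

section \<open>Functions in the Paley-Wiener space with prescribed zeros\<close>

lemma entire_factor:
  fixes h :: "complex \<Rightarrow> complex"
  assumes "h holomorphic_on UNIV" "h a = 0"
  obtains h1 where "h1 holomorphic_on UNIV" "\<And>z. h z = (z - a) * h1 z"
proof
  show "(\<lambda>z. if z = a then deriv h a else (h z - h a) / (z - a)) holomorphic_on UNIV"
    by (rule pole_lemma_open[OF assms(1) open_UNIV])
qed (use assms in auto)

lemma entire_factor_prod:
  fixes h :: "complex \<Rightarrow> complex" and e :: "'i \<Rightarrow> complex"
  assumes "h holomorphic_on UNIV" "finite I" "inj_on e I" "\<And>i. i \<in> I \<Longrightarrow> h (e i) = 0"
  obtains h1 where "h1 holomorphic_on UNIV" "\<And>z. h z = (\<Prod>i\<in>I. z - e i) * h1 z"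
proof -
  have "\<exists>h1. h1 holomorphic_on UNIV \<and> (\<forall>z. h z = (\<Prod>i\<in>I. z - e i) * h1 z)"
    using assms(2-4)
  proof (induction I)
    case empty
    then show ?case using assms(1) by auto
  next
    case (insert j I)
    then obtain h1 where h1: "h1 holomorphic_on UNIV" "\<And>z. h z = (\<Prod>i\<in>I. z - e i) * h1 z"
      by auto
    have "(\<Prod>i\<in>I. e j - e i) \<noteq> 0"
      using insert.hyps insert.prems(1) by (auto simp: inj_on_def)
    then have "h1 (e j) = 0"
      using insert.prems(2)[of j] h1(2)[of "e j"] by simp
    then obtain h2 where "h2 holomorphic_on UNIV" "\<And>z. h1 z = (z - e j) * h2 z"
      using entire_factor[OF h1(1)] by blast
    then show ?case
      using insert.hyps by (intro exI[of _ h2]) (simp add: h1(2) mult_ac)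
  qed
  then show thesis using that by blast
qed

text \<open>Where one factor is nonzero, on an open set, the other vanishes. This turns the
  pointwise sign in g = +-u into a global one.\<close>

lemma entire_mult_eq_0:
  fixes u v :: "complex \<Rightarrow> complex"
  assumes u: "u holomorphic_on UNIV" and v: "v holomorphic_on UNIV" and uv: "\<And>z. u z * v z = 0"
  shows "(\<forall>z. u z = 0) \<or> (\<forall>z. v z = 0)"
proof (rule disjCI)
  assume "\<not> (\<forall>z. v z = 0)"
  then obtain z0 where z0: "v z0 \<noteq> 0" by auto
  have "open {z. v z \<noteq> 0}"
    using holomorphic_on_imp_continuous_on[OF v] by (intro open_Collect_neq) auto
  then have "z0 islimpt {z. v z \<noteq> 0}"
    using z0 by (intro interior_limit_point) (simp add: interior_open)
  moreover have "u z = 0" if "z \<in> {z. v z \<noteq> 0}" for z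
    using uv[of z] that by auto
  ultimately show "\<forall>z. u z = 0"
    using analytic_continuation[OF u open_UNIV connected_UNIV, of "{z. v z \<noteq> 0}" z0] by blast
qed

text \<open>Each power of \<open>s\<close> buys one power of decay, in every direction once the
  exponential is split off, for one unit of type.\<close>

lemma entire_sinc_exists:
  obtains s C where "s holomorphic_on UNIV" "real_on_reals s" "\<And>z. sin z = z * s z"
    "\<And>z. cmod (s z) \<le> C * exp \<bar>Im z\<bar> / (1 + cmod z)"
proof -
  have "(\<lambda>z::complex. sin z) holomorphic_on UNIV" by (intro holomorphic_intros)
  then obtain s where s: "s holomorphic_on UNIV" "\<And>z. sin z = (z - 0) * s z"
    using entire_factor[of sin 0] sin_zero by metis
  then have s': "sin z = z * s z" for z by simp
  \<comment> \<open>The equation sin z = z s(z) says nothing about \<open>s 0\<close> directly;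
    differentiating it at 0 does. The value is needed for \<open>s\<close> to be real there.\<close>
  have "(sin has_field_derivative s 0) (at 0)"
  proof -
    have "((\<lambda>z. z * s z) has_field_derivative 0 * deriv s 0 + 1 * s 0) (at 0)"
      by (rule DERIV_mult' [OF DERIV_ident holomorphic_derivI[OF s(1) open_UNIV]]) simp
    then show ?thesis by (simp add: s'[symmetric])
  qed
  moreover have "(sin has_field_derivative 1) (at (0::complex))"
    by (auto intro!: derivative_eq_intros)
  ultimately have s0: "s 0 = 1" by (rule DERIV_unique)
  have real: "real_on_reals s"
    unfolding real_on_reals_def
  proof
    fix t :: real
    show "s (of_real t) \<in> \<real>"
    proof (cases "t = 0")
      case False
      then have "s (of_real t) = of_real (sin t / t)"
        using s'[of "of_real t"] by (simp add: field_simps sin_of_real)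
      then show ?thesis by (metis Reals_of_real)
    qed (use s0 in simp)
  qed
  have "compact (s ` cball 0 1)"
    using s(1) by (intro compact_continuous_image)
      (auto intro: holomorphic_on_imp_continuous_on holomorphic_on_subset)
  then have "bounded (s ` cball 0 1)" by (rule compact_imp_bounded)
  then obtain B where "\<forall>w \<in> s ` cball 0 1. cmod w \<le> B"
    unfolding bounded_iff by blast
  then have B: "cmod (s z) \<le> B" if "cmod z \<le> 1" for z
    using that by simp
  define C where "C = 2 * max B 1"
  have "cmod (s z) \<le> C * exp \<bar>Im z\<bar> / (1 + cmod z)" for z
  proof (cases "cmod z \<le> 1")
    case True
    have "cmod (s z) * (1 + cmod z) \<le> max B 1 * (1 + cmod z)"
      using B[OF True] by (intro mult_right_mono) auto
    also have "\<dots> \<le> max B 1 * 2"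
      using True by (intro mult_left_mono) auto
    also have "\<dots> \<le> C * exp \<bar>Im z\<bar>"
      using mult_left_mono[of 1 "exp \<bar>Im z\<bar>" C] by (simp add: C_def)
    finally show ?thesis by (simp add: pos_le_divide_eq add_pos_nonneg)
  next
    case False
    have "cmod (s z) * cmod z \<le> exp \<bar>Im z\<bar>"
      using cmod_sin_le_exp[of 1 z] by (simp add: s' norm_mult mult.commute)
    moreover have "cmod (s z) * (1 + cmod z) \<le> cmod (s z) * (2 * cmod z)"
      using False by (intro mult_left_mono) auto
    moreover have "2 * exp \<bar>Im z\<bar> \<le> C * exp \<bar>Im z\<bar>"
      by (intro mult_right_mono) (auto simp: C_def)
    ultimately have "cmod (s z) * (1 + cmod z) \<le> C * exp \<bar>Im z\<bar>" by linarith
    then show ?thesis by (simp add: pos_le_divide_eq add_pos_nonneg)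
  qed
  then show thesis using that s(1) real s' by blast
qed

text \<open>For finite p the p-th power of the decay is dominated on the real line by a multiple of
  1/(1 + t^2) once m p >= 2, also for p < 1.\<close>

lemma PW_I:
  fixes f :: "complex \<Rightarrow> complex"
  assumes hol: "f holomorphic_on UNIV"
    and decay: "\<And>z. cmod (f z) \<le> C * exp (pi * b * \<bar>Im z\<bar>) / (1 + cmod z) ^ m"
    and b: "b > 0" and m: "p \<noteq> \<infinity> \<Longrightarrow> real m * enn2real p \<ge> 2"
  shows "f \<in> PW p b"
proof -
  have C: "C \<ge> 0"
    using decay[of 0] norm_ge_zero[of "f 0"] by (simp del: norm_ge_zero)
  have "cmod (f z) \<le> C * exp (pi * b * cmod z)" for z
  proof -
    have "cmod (f z) \<le> C * exp (pi * b * \<bar>Im z\<bar>) / (1 + cmod z) ^ m" by (rule decay)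
    also have "\<dots> \<le> C * exp (pi * b * \<bar>Im z\<bar>) / 1"
      using C by (intro frac_le one_le_power) auto
    also have "\<dots> \<le> C * exp (pi * b * cmod z)"
      using C b abs_Im_le_cmod[of z] by (auto intro!: mult_left_mono)
    finally show ?thesis .
  qed
  then have "exponential_type f \<le> ereal (pi * b)"
    unfolding exponential_type_def by (intro INF_lower) blast
  moreover have "Lp_fun p (\<lambda>t. f (complex_of_real t))"
  proof -
    have "continuous_on UNIV (\<lambda>t. f (complex_of_real t))"
      by (rule continuous_on_compose2[OF holomorphic_on_imp_continuous_on[OF hol]
            continuous_on_of_real[OF continuous_on_id]]) simp
    then have meas: "(\<lambda>t. f (complex_of_real t)) \<in> borel_measurable borel"
      by (rule borel_measurable_continuous_onI)
    have dec: "cmod (f (of_real t)) \<le> C / (1 + \<bar>t\<bar>) ^ m" for t :: real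
      using decay[of "of_real t"] by simp
    show ?thesis
    proof (cases "p = \<infinity>")
      case True
      have "C / (1 + \<bar>t\<bar>) ^ m \<le> C / 1" for t :: real
        using C by (intro frac_le one_le_power) auto
      then have "cmod (f (of_real t)) \<le> C" for t :: real
        using dec[of t] by (auto intro: order_trans)
      then show ?thesis using True meas by (auto simp: Lp_fun_def)
    next
      case False
      define q where "q = enn2real p"
      have q: "q \<ge> 0" "real m * q \<ge> 2" using m[OF False] by (auto simp: q_def)
      have "integrable lborel (\<lambda>t::real. inverse (1 + t\<^sup>2))"
        using integrable_inverse_1_plus_square by (simp add: set_integrable_def)
      then have int: "integrable lborel (\<lambda>t::real. C powr q * inverse (1 + t\<^sup>2))"
        by (rule integrable_mult_right)
      have "cmod (f (of_real t)) powr q \<le> C powr q * inverse (1 + t\<^sup>2)" for t :: real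
      proof -
        have "cmod (f (of_real t)) powr q \<le> (C / (1 + \<bar>t\<bar>) ^ m) powr q"
          using dec[of t] q by (intro powr_mono2) auto
        also have "\<dots> = C powr q / ((1 + \<bar>t\<bar>) powr (real m * q))"
        proof -
          have "(1 + \<bar>t\<bar>) ^ m = (1 + \<bar>t\<bar>) powr real m"
            by (rule powr_realpow[symmetric]) simp
          then have "((1 + \<bar>t\<bar>) ^ m) powr q = (1 + \<bar>t\<bar>) powr (real m * q)"
            by (simp only: powr_powr)
          then show ?thesis using C by (simp only: powr_divide zero_le_power abs_ge_zero add_nonneg_nonneg zero_le_one)
        qed
        also have "\<dots> \<le> C powr q / ((1 + \<bar>t\<bar>) powr 2)"
          using q by (intro divide_left_mono powr_mono) auto
        also have "\<dots> = C powr q / (1 + \<bar>t\<bar>)\<^sup>2" by simp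
        also have "\<dots> \<le> C powr q / (1 + t\<^sup>2)"
        proof (intro divide_left_mono)
          show "1 + t\<^sup>2 \<le> (1 + \<bar>t\<bar>)\<^sup>2" by (simp add: power2_sum)
        qed (auto intro!: mult_pos_pos add_pos_nonneg)
        finally show ?thesis by (simp add: divide_inverse)
      qed
      then have "integrable lborel (\<lambda>t. cmod (f (complex_of_real t)) powr q)"
        using meas by (intro Bochner_Integration.integrable_bound[OF int]) auto
      then show ?thesis using False meas by (simp add: Lp_fun_def q_def)
    qed
  qed
  ultimately show ?thesis using hol by (simp add: PW_def)
qed

text \<open>The infimum defining the type need not be attained, hence the strict inequality.\<close>

lemma PW_growth:
  assumes "f \<in> PW p b" "pi * b < \<beta>"
  obtains C where "C \<ge> 0" "\<And>z. cmod (f z) \<le> C * exp (\<beta> * cmod z)"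
proof -
  have "exponential_type f < ereal \<beta>"
    using assms by (auto simp: PW_def intro: le_less_trans)
  then obtain \<gamma> C where \<gamma>: "\<gamma> < \<beta>" "\<And>z. cmod (f z) \<le> C * exp (\<gamma> * cmod z)"
    unfolding exponential_type_def by (auto simp: INF_less_iff)
  have C: "C \<ge> 0"
    using \<gamma>(2)[of 0] norm_ge_zero[of "f 0"] by (simp del: norm_ge_zero)
  have "cmod (f z) \<le> C * exp (\<beta> * cmod z)" for z
  proof -
    have "C * exp (\<gamma> * cmod z) \<le> C * exp (\<beta> * cmod z)"
      using C \<gamma>(1) by (auto intro!: mult_left_mono mult_right_mono)
    then show ?thesis using \<gamma>(2)[of z] by linarith
  qed
  then show thesis using C that by blast
qed

lemma separated_seq_imp_dist_ge:
  assumes "separated_seq x" "\<forall>k. x k < x (k + 1)"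
  obtains \<sigma> where "\<sigma> > 0" "\<And>i j. \<sigma> * \<bar>of_int (i - j)\<bar> \<le> \<bar>x i - x j\<bar>"
proof -
  define \<sigma> where "\<sigma> = (INF k. \<bar>x (k + 1) - x k\<bar>)"
  have step: "\<sigma> \<le> x (k + 1) - x k" for k
  proof -
    have "\<sigma> \<le> \<bar>x (k + 1) - x k\<bar>"
      unfolding \<sigma>_def by (rule cINF_lower) (auto intro!: bdd_belowI[of _ 0])
    then show ?thesis using assms(2)[rule_format, of k] by simp
  qed
  have nat_step: "\<sigma> * real n \<le> x (j + int n) - x j" for j n
  proof (induction n)
    case (Suc n)
    then show ?case using step[of "j + int n"] by (simp add: algebra_simps)
  qed simp
  have "\<sigma> * \<bar>of_int (i - j)\<bar> \<le> \<bar>x i - x j\<bar>" for i j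
  proof (cases "i \<ge> j")
    case True
    then show ?thesis using nat_step[of "nat (i - j)" j] by simp
  next
    case False
    then show ?thesis using nat_step[of "nat (j - i)" i] by simp
  qed
  moreover have "\<sigma> > 0" using assms(1) by (simp add: separated_seq_def \<sigma>_def)
  ultimately show thesis using that by blast
qed

lemma card_int_abs_le:
  fixes r :: real
  shows "finite {k::int. \<bar>of_int k\<bar> \<le> r}" "r \<ge> 0 \<Longrightarrow> real (card {k::int. \<bar>of_int k\<bar> \<le> r}) \<le> 2 * r + 1"
proof -
  have eq: "{k::int. \<bar>of_int k\<bar> \<le> r} = {- \<lfloor>r\<rfloor>..\<lfloor>r\<rfloor>}"
    by (auto simp: abs_le_iff le_floor_iff) (simp_all add: minus_le_iff le_floor_iff)
  show "finite {k::int. \<bar>of_int k\<bar> \<le> r}" unfolding eq by simp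
  assume "r \<ge> 0"
  then show "real (card {k::int. \<bar>of_int k\<bar> \<le> r}) \<le> 2 * r + 1"
    unfolding eq by simp
qed

text \<open>The function is P(\<delta> w) s(\<eta> w)^N with w = z - y(0): \<open>P\<close> spends
  the type pi \<delta>, and the sinc power spends half of the remaining pi (b - \<delta>). The sinc
  zeros have multiplicity \<open>N\<close> but, as a set, density only \<eta>/pi, whence the bound
  on \<delta> + \<eta>/pi.\<close>

lemma decaying_function_with_zeros:
  fixes y :: "int \<Rightarrow> real"
  assumes \<delta>: "0 < \<delta>" "\<delta> < b" and near: "\<And>k. \<bar>y k - of_int k / \<delta>\<bar> \<le> L"
    and sep: "\<sigma> > 0" "\<And>k. \<sigma> * \<bar>of_int k\<bar> \<le> \<bar>y k - y 0\<bar>"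
  obtains f C \<eta> where "f holomorphic_on UNIV" "real_on_reals f"
    "\<And>z. cmod (f z) \<le> C * exp (pi * b * \<bar>Im z\<bar>) / (1 + cmod z) ^ m"
    "\<And>k. f (of_real (y k)) = 0" "\<eta> > 0" "\<delta> + \<eta> / pi < b"
    "\<And>t::real. f (of_real t) = 0 \<Longrightarrow> t \<in> range y \<or> sin (\<eta> * (t - y 0)) = 0"
proof -
  \<comment> \<open>Normalized to contain 0 and to have density 1; the translation doubles the
    deviation \<open>L\<close>.\<close>
  define y' where "y' k = \<delta> * (y k - y 0)" for k
  have y'0: "y' 0 = 0" by (simp add: y'_def)
  have y'_near: "\<bar>y' k - of_int k\<bar> \<le> \<delta> * (2 * L)" for k
  proof -
    have "y' k - of_int k = \<delta> * ((y k - of_int k / \<delta>) - (y 0 - of_int 0 / \<delta>))"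
      using \<delta> by (simp add: y'_def field_simps)
    then have "\<bar>y' k - of_int k\<bar> = \<delta> * \<bar>(y k - of_int k / \<delta>) - (y 0 - of_int 0 / \<delta>)\<bar>"
      using \<delta> by (simp only: abs_mult abs_of_pos)
    also have "\<bar>(y k - of_int k / \<delta>) - (y 0 - of_int 0 / \<delta>)\<bar> \<le> 2 * L"
      using near[of k] near[of 0] by linarith
    finally show ?thesis using \<delta> by simp
  qed
  have y'_lower: "(\<delta> * \<sigma>) * \<bar>of_int k\<bar> \<le> \<bar>y' k\<bar>" for k
    using \<delta> sep(2)[of k] by (simp add: y'_def abs_mult)
  obtain P C1 M where P: "P holomorphic_on UNIV" "real_on_reals P"
    "\<And>z. P z = 0 \<longleftrightarrow> z \<in> range (\<lambda>k. complex_of_real (y' k))"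
    "\<And>z. cmod (P z) \<le> C1 * (3 + cmod z) ^ M * exp (pi * \<bar>Im z\<bar>)"
    using canonical_product_exists[OF y'0 y'_near y'_lower] \<delta> sep(1) by (metis mult_pos_pos)
  obtain s C2 where s: "s holomorphic_on UNIV" "real_on_reals s" "\<And>z. sin z = z * s z"
    "\<And>z. cmod (s z) \<le> C2 * exp \<bar>Im z\<bar> / (1 + cmod z)"
    using entire_sinc_exists by blast
  \<comment> \<open>\<open>M\<close> powers cancel the growth of \<open>P\<close>, \<open>m\<close>
    give the decay, and one more keeps \<open>N\<close> positive.\<close>
  define N where "N = M + m + 1"
  define \<eta> where "\<eta> = pi * (b - \<delta>) / (2 * real N)"
  have \<eta>: "\<eta> > 0" using \<delta> by (simp add: \<eta>_def N_def)
  have N\<eta>: "real N * \<eta> = pi * (b - \<delta>) / 2"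
  proof -
    have "real N \<noteq> 0" by (simp add: N_def)
    then show ?thesis by (simp add: \<eta>_def)
  qed
  have dens: "\<delta> + \<eta> / pi < b"
  proof -
    have "1 * \<eta> \<le> real N * \<eta>" using \<eta> by (intro mult_right_mono) (auto simp: N_def)
    also have "\<dots> < pi * (b - \<delta>)" unfolding N\<eta> using \<delta> by simp
    finally show ?thesis by (simp add: field_simps)
  qed
  define f where "f z = P (of_real \<delta> * (z - of_real (y 0))) * s (of_real \<eta> * (z - of_real (y 0))) ^ N" for z
  have hol: "f holomorphic_on UNIV"
  proof -
    have "(P \<circ> (\<lambda>z. of_real \<delta> * (z - of_real (y 0)))) holomorphic_on UNIV"
      "(s \<circ> (\<lambda>z. of_real \<eta> * (z - of_real (y 0)))) holomorphic_on UNIV"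
      by (rule holomorphic_on_compose_gen[of _ _ _ UNIV]; (intro holomorphic_intros P(1) s(1))?; simp)+
    then show ?thesis
      unfolding f_def o_def by (intro holomorphic_intros)
  qed
  have real: "real_on_reals f"
    unfolding real_on_reals_def f_def
  proof
    fix t :: real
    have "P (of_real (\<delta> * (t - y 0))) * s (of_real (\<eta> * (t - y 0))) ^ N \<in> \<real>"
      using P(2) s(2) unfolding real_on_reals_def by (intro Reals_mult Reals_power) blast+
    then show "P (of_real \<delta> * (of_real t - of_real (y 0))) * s (of_real \<eta> * (of_real t - of_real (y 0))) ^ N \<in> \<real>"
      by simp
  qed
  have C1: "C1 \<ge> 0"
  proof -
    have "0 \<le> C1 * 3 ^ M" using order_trans[OF norm_ge_zero P(4)[of 0]] by simp
    then show ?thesis by (metis not_le zero_le_mult_iff zero_less_numeral zero_less_power)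
  qed
  have C2: "C2 \<ge> 0"
    using s(4)[of 0] norm_ge_zero[of "s 0"] by (simp del: norm_ge_zero)
  define C where "C = C1 * (3 + \<delta>) ^ M * (C2 * (1 + 1 / \<eta>)) ^ N * (1 + \<bar>y 0\<bar>) ^ m"
  have bound: "cmod (f z) \<le> C * exp (pi * b * \<bar>Im z\<bar>) / (1 + cmod z) ^ m" for z
  proof -
    define w where "w = z - of_real (y 0)"
    define r where "r = cmod w"
    have r: "r \<ge> 0" by (simp add: r_def)
    have "3 + \<delta> * r \<le> (3 + \<delta>) * (1 + r)"
      using \<delta> r by (simp add: algebra_simps)
    then have "(3 + \<delta> * r) ^ M \<le> ((3 + \<delta>) * (1 + r)) ^ M"
      using \<delta> r by (intro power_mono) auto
    then have "C1 * (3 + \<delta> * r) ^ M * exp (pi * (\<delta> * \<bar>Im w\<bar>)) \<le>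
        C1 * ((3 + \<delta>) * (1 + r)) ^ M * exp (pi * (\<delta> * \<bar>Im w\<bar>))"
      using C1 by (intro mult_right_mono mult_left_mono) auto
    then have P_le: "cmod (P (of_real \<delta> * w)) \<le> C1 * ((3 + \<delta>) * (1 + r)) ^ M * exp (pi * (\<delta> * \<bar>Im w\<bar>))"
      using P(4)[of "of_real \<delta> * w"] \<delta> by (simp add: norm_mult r_def abs_mult)
    have "1 + r \<le> (1 + 1 / \<eta>) * (1 + \<eta> * r)"
      using \<eta> r by (simp add: algebra_simps add_increasing)
    then have "1 / (1 + \<eta> * r) \<le> (1 + 1 / \<eta>) / (1 + r)"
      using \<eta> r by (simp add: pos_divide_le_eq pos_le_divide_eq add_pos_nonneg mult.commute)
    then have "C2 * exp (\<eta> * \<bar>Im w\<bar>) * (1 / (1 + \<eta> * r)) \<le> C2 * exp (\<eta> * \<bar>Im w\<bar>) * ((1 + 1 / \<eta>) / (1 + r))"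
      using C2 by (intro mult_left_mono) auto
    then have "cmod (s (of_real \<eta> * w)) \<le> C2 * (1 + 1 / \<eta>) * exp (\<eta> * \<bar>Im w\<bar>) / (1 + r)"
      using s(4)[of "of_real \<eta> * w"] \<eta> by (simp add: norm_mult r_def abs_mult mult_ac)
    then have s_le: "cmod (s (of_real \<eta> * w)) ^ N \<le> (C2 * (1 + 1 / \<eta>) * exp (\<eta> * \<bar>Im w\<bar>) / (1 + r)) ^ N"
      by (intro power_mono) auto
    have split: "1 / (1 + r) ^ N * (1 + r) ^ M \<le> 1 / (1 + r) ^ m"
    proof -
      have "1 / (1 + r) ^ N * (1 + r) ^ M = 1 / ((1 + r) ^ m * (1 + r))"
        using r by (simp add: N_def power_add add_nonneg_eq_0_iff)
      also have "\<dots> \<le> 1 / ((1 + r) ^ m * 1)"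
        using r by (intro divide_left_mono mult_left_mono) (auto intro!: mult_pos_pos add_pos_nonneg)
      finally show ?thesis by simp
    qed
    have "1 + cmod z \<le> (1 + \<bar>y 0\<bar>) * (1 + r)"
    proof -
      have "cmod z \<le> r + \<bar>y 0\<bar>"
        using norm_triangle_ineq[of w "of_real (y 0)"] by (simp add: w_def r_def)
      moreover have "0 \<le> r * \<bar>y 0\<bar>" using r by simp
      ultimately show ?thesis by (simp add: algebra_simps)
    qed
    then have "(1 + cmod z) ^ m \<le> ((1 + \<bar>y 0\<bar>) * (1 + r)) ^ m"
      by (intro power_mono) auto
    then have dec: "1 / (1 + r) ^ m \<le> (1 + \<bar>y 0\<bar>) ^ m / (1 + cmod z) ^ m"
      using r by (simp add: power_mult_distrib pos_divide_le_eq pos_le_divide_eq add_pos_nonneg mult.commute)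
    define E where "E = exp (pi * (\<delta> * \<bar>Im w\<bar>)) * exp (\<eta> * \<bar>Im w\<bar>) ^ N"
    have E: "E \<le> exp (pi * b * \<bar>Im z\<bar>)"
    proof -
      have "E = exp ((pi * \<delta> + real N * \<eta>) * \<bar>Im w\<bar>)"
        by (simp add: E_def algebra_simps flip: exp_add exp_of_nat_mult)
      also have "\<dots> \<le> exp (pi * b * \<bar>Im w\<bar>)"
        unfolding exp_le_cancel_iff N\<eta> using \<delta> by (intro mult_right_mono) (auto simp: field_simps)
      finally show ?thesis by (simp add: w_def)
    qed
    have "cmod (f z) = cmod (P (of_real \<delta> * w)) * cmod (s (of_real \<eta> * w)) ^ N"
      by (simp add: f_def w_def norm_mult norm_power)
    also have "\<dots> \<le> (C1 * ((3 + \<delta>) * (1 + r)) ^ M * exp (pi * (\<delta> * \<bar>Im w\<bar>))) *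
        (C2 * (1 + 1 / \<eta>) * exp (\<eta> * \<bar>Im w\<bar>) / (1 + r)) ^ N"
      using C1 \<delta> r by (intro mult_mono P_le s_le) auto
    also have "\<dots> = C1 * (3 + \<delta>) ^ M * (C2 * (1 + 1 / \<eta>)) ^ N * (E * (1 / (1 + r) ^ N * (1 + r) ^ M))"
      by (simp only: power_mult_distrib power_divide E_def) simp
    also have "\<dots> \<le> C1 * (3 + \<delta>) ^ M * (C2 * (1 + 1 / \<eta>)) ^ N *
        (exp (pi * b * \<bar>Im z\<bar>) * ((1 + \<bar>y 0\<bar>) ^ m / (1 + cmod z) ^ m))"
      using C1 C2 \<delta> \<eta> r split dec
      by (intro mult_left_mono mult_mono E) auto
    also have "\<dots> = C * exp (pi * b * \<bar>Im z\<bar>) / (1 + cmod z) ^ m"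
      by (simp add: C_def)
    finally show ?thesis .
  qed
  have zero: "f (of_real (y k)) = 0" for k
  proof -
    have "P (complex_of_real (y' k)) = 0" unfolding P(3) by blast
    then show ?thesis by (simp add: f_def y'_def)
  qed
  have zeros: "t \<in> range y \<or> sin (\<eta> * (t - y 0)) = 0" if "f (of_real t) = 0" for t
  proof -
    from that consider "P (of_real (\<delta> * (t - y 0))) = 0" | "s (of_real (\<eta> * (t - y 0))) = 0"
      by (auto simp: f_def)
    then show ?thesis
    proof cases
      case 1
      then obtain k where "complex_of_real (\<delta> * (t - y 0)) = of_real (y' k)"
        unfolding P(3) by blast
      then have "\<delta> * (t - y 0) = \<delta> * (y k - y 0)"
        unfolding of_real_eq_iff y'_def .
      then have "t = y k" using \<delta> by simp
      then show ?thesis by blast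
    next
      case 2
      then have "complex_of_real (sin (\<eta> * (t - y 0))) = 0"
        using s(3)[of "of_real (\<eta> * (t - y 0))"] by (simp only: sin_of_real mult_zero_right)
      then show ?thesis by simp
    qed
  qed
  show thesis
    by (rule that[OF hol real bound zero \<eta> dens zeros])
qed

lemma sin_zeros_eq_range:
  assumes "\<eta> > 0"
  shows "{t. sin (\<eta> * (t - c)) = 0} = range (\<lambda>j::int. c + of_int j * pi / \<eta>)"
proof -
  have "t \<in> range (\<lambda>j::int. c + of_int j * pi / \<eta>)" if "sin (\<eta> * (t - c)) = 0" for t
  proof -
    obtain j :: int where "\<eta> * (t - c) = of_int j * pi"
      using \<open>sin _ = 0\<close> by (auto simp: sin_zero_iff_int2)
    then have "t = c + of_int j * pi / \<eta>" using assms by (simp add: field_simps)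
    then show ?thesis by blast
  qed
  then show ?thesis using assms by (auto simp: sin_zero_iff_int2)
qed

section \<open>Uniqueness and the density of zeros\<close>

text \<open>The real zeros lie in a countable set, so some real point is not a zero.\<close>

lemma nonzero_of_zeros_countable:
  fixes f :: "complex \<Rightarrow> complex" and y :: "int \<Rightarrow> real"
  assumes "\<eta> > 0" and "\<And>t::real. f (of_real t) = 0 \<Longrightarrow> t \<in> range y \<or> sin (\<eta> * (t - c)) = 0"
  obtains z where "f z \<noteq> 0"
proof -
  have "countable (range y \<union> {t. sin (\<eta> * (t - c)) = 0})"
    unfolding sin_zeros_eq_range[OF assms(1)] by simp
  then have "range y \<union> {t. sin (\<eta> * (t - c)) = 0} \<noteq> UNIV"
    using uncountable_UNIV_real by metis
  then show thesis using assms(2) that by blast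
qed

text \<open>Counting indices instead of points: y(k) in [-r, r] forces |k| <= \<delta> (r + L), and
  similarly for the sine zeros, so the count is at most 2r (\<delta> + \<eta>/pi) plus a
  constant.\<close>

lemma zeros_density_le:
  fixes f :: "complex \<Rightarrow> complex" and y :: "int \<Rightarrow> real"
  assumes \<delta>: "\<delta> > 0" and near: "\<And>k. \<bar>y k - of_int k / \<delta>\<bar> \<le> L" and \<eta>: "\<eta> > 0"
    and zeros: "\<And>t::real. f (of_real t) = 0 \<Longrightarrow> t \<in> range y \<or> sin (\<eta> * (t - c)) = 0"
    and Y: "\<forall>t\<in>Y. f (of_real t) = 0"
    and lim: "((\<lambda>r::real. real (count_in Y {-r..r}) / (2 * r)) \<longlongrightarrow> l) at_top"
  shows "l \<le> \<delta> + \<eta> / pi"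
proof -
  have L: "L \<ge> 0" using near[of 0] by linarith
  define K where "K = 2 * \<delta> * L + 2 * (\<eta> / pi * \<bar>c\<bar>) + 2"
  have le: "real (count_in Y {-r..r}) \<le> (\<delta> + \<eta> / pi) * (2 * r) + K" if r: "r > 0" for r
  proof -
    define A where "A = {k::int. \<bar>of_int k\<bar> \<le> \<delta> * (r + L)}"
    define B where "B = {k::int. \<bar>of_int k\<bar> \<le> \<eta> / pi * (r + \<bar>c\<bar>)}"
    have fin: "finite A" "finite B" unfolding A_def B_def by (rule card_int_abs_le(1))+
    have cA: "real (card A) \<le> 2 * (\<delta> * (r + L)) + 1"
      unfolding A_def using \<delta> r L by (intro card_int_abs_le(2)) auto
    have cB: "real (card B) \<le> 2 * (\<eta> / pi * (r + \<bar>c\<bar>)) + 1"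
      unfolding B_def using \<eta> r by (intro card_int_abs_le(2)) auto
    have "Y \<inter> {-r..r} \<subseteq> y ` A \<union> (\<lambda>j::int. c + of_int j * pi / \<eta>) ` B"
    proof
      fix t assume t: "t \<in> Y \<inter> {-r..r}"
      then have "t \<in> range y \<or> t \<in> {t. sin (\<eta> * (t - c)) = 0}" using zeros[of t] Y by auto
      then consider k where "t = y k" | j :: int where "t = c + of_int j * pi / \<eta>"
        unfolding sin_zeros_eq_range[OF \<eta>] by blast
      then show "t \<in> y ` A \<union> (\<lambda>j::int. c + of_int j * pi / \<eta>) ` B"
      proof cases
        case 1
        then have "\<bar>of_int k / \<delta>\<bar> \<le> r + L"
          using near[of k] t by auto
        then have "k \<in> A" using \<delta> by (simp add: A_def field_simps)
        then show ?thesis using 1 by blast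
      next
        case 2
        then have "\<bar>of_int j * pi / \<eta>\<bar> \<le> r + \<bar>c\<bar>" using t by auto
        then have "j \<in> B" using \<eta> by (simp add: B_def abs_mult field_simps)
        then show ?thesis using 2 by blast
      qed
    qed
    then have "card (Y \<inter> {-r..r}) \<le> card (y ` A \<union> (\<lambda>j::int. c + of_int j * pi / \<eta>) ` B)"
      using fin by (intro card_mono) auto
    also have "\<dots> \<le> card A + card B"
      using card_Un_le card_image_le[OF fin(1)] card_image_le[OF fin(2)] by (meson add_mono order_trans)
    finally have "real (count_in Y {-r..r}) \<le> real (card A) + real (card B)"
      by (simp add: count_in_def)
    then show ?thesis using cA cB by (simp add: K_def algebra_simps)
  qed
  have "((\<lambda>r. (\<delta> + \<eta> / pi) + K / (2 * r)) \<longlongrightarrow> (\<delta> + \<eta> / pi) + 0) at_top"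
    by (intro tendsto_intros tendsto_divide_0[OF tendsto_const] filterlim_at_top_imp_at_infinity
        filterlim_tendsto_pos_mult_at_top[OF tendsto_const _ filterlim_ident]) auto
  moreover have "eventually (\<lambda>r::real. real (count_in Y {-r..r}) / (2 * r) \<le> (\<delta> + \<eta> / pi) + K / (2 * r)) at_top"
    using eventually_gt_at_top[of 0]
  proof eventually_elim
    case (elim r)
    then have "real (count_in Y {-r..r}) / (2 * r) \<le> ((\<delta> + \<eta> / pi) * (2 * r) + K) / (2 * r)"
      using le by (intro divide_right_mono) auto
    also have "\<dots> = (\<delta> + \<eta> / pi) + K / (2 * r)" using elim by (simp add: add_divide_distrib)
    finally show ?case .
  qed
  ultimately show ?thesis
    using tendsto_le[OF trivial_limit_at_top_linorder _ lim] by fastforce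
qed

text \<open>
  The sequence \<open>a\<close> in the proof lists the zeros of \<open>g\<^sup>2 - f\<^sup>2\<close> on a half line in increasing order, the
  even-indexed points twice.
\<close>

lemma square_eq_of_abs_eq:
  fixes f g :: "complex \<Rightarrow> complex" and x :: "int \<Rightarrow> real"
  assumes hol: "f holomorphic_on UNIV" "g holomorphic_on UNIV"
    and bound: "\<And>z. cmod (f z) \<le> C * exp (\<beta> * cmod z)" "\<And>z. cmod (g z) \<le> C * exp (\<beta> * cmod z)"
    and \<beta>: "0 \<le> \<beta>" "2 * \<beta> / pi < 3 / 2 * d"
    and mono: "strict_mono x" and near: "\<And>k. \<bar>x k - of_int k / d\<bar> \<le> L" and d: "d > 0"
    and even: "\<And>k. f (of_real (x (2 * k))) = 0" "\<And>k. g (of_real (x (2 * k))) = 0"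
    and odd: "\<And>k. (g (of_real (x (2 * k + 1))))\<^sup>2 = (f (of_real (x (2 * k + 1))))\<^sup>2"
  shows "(g z)\<^sup>2 = (f z)\<^sup>2"
proof -
  define F where "F z = (g z)\<^sup>2 - (f z)\<^sup>2" for z
  \<comment> \<open>From index \<open>2 * n0\<close> on, the points are at least (L + 1) - L = 1, as
    required for the lower bound \<rho> = 1.\<close>
  define n0 where "n0 = \<lceil>d * (L + 1)\<rceil>"
  define e where "e j = complex_of_real (x (2 * n0 + 2 * int j))" for j :: nat
  define o' where "o' j = complex_of_real (x (2 * n0 + 2 * int j + 1))" for j :: nat
  define a where "a n = x (2 * n0 + 2 * int (n div 3) + (if n mod 3 = 2 then 1 else 0))" for n
  have L: "L \<ge> 0" using near[of 0] by linarith
  have inj_x: "inj x" using mono by (rule strict_mono_imp_inj_on)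
  have inj: "inj e" "inj o'"
    by (auto simp: inj_def e_def o'_def inj_eq[OF inj_x])
  have eo: "o' j \<noteq> e i" for i j
    by (simp add: e_def o'_def inj_eq[OF inj_x]) presburger
  have zeros3: "\<exists>G. G holomorphic_on UNIV \<and> (\<forall>z. F z = (\<Prod>n<3*N. z - of_real (a n)) * G z)" for N
  proof -
    have e_zero: "f (e j) = 0" "g (e j) = 0" for j
      using even[of "n0 + int j"] by (simp_all add: e_def distrib_left)
    have inj_N: "inj_on e {..<N}" "inj_on o' {..<N}"
      using inj by (auto intro: inj_on_subset)
    \<comment> \<open>Dividing \<open>f\<close> and \<open>g\<close> separately makes the even
      points double zeros of the difference of squares; the common factor does not vanish at the odd
      points, so these survive as zeros of g1^2 - f1^2.\<close>
    obtain f1 where f1: "f1 holomorphic_on UNIV" "\<And>z. f z = (\<Prod>j<N. z - e j) * f1 z"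
      using entire_factor_prod[OF hol(1) finite_lessThan inj_N(1) e_zero(1)] by blast
    obtain g1 where g1: "g1 holomorphic_on UNIV" "\<And>z. g z = (\<Prod>j<N. z - e j) * g1 z"
      using entire_factor_prod[OF hol(2) finite_lessThan inj_N(1) e_zero(2)] by blast
    have o_zero: "(g1 (o' j))\<^sup>2 - (f1 (o' j))\<^sup>2 = 0" for j
    proof -
      have "(g (o' j))\<^sup>2 = (f (o' j))\<^sup>2"
        using odd[of "n0 + int j"] by (simp add: o'_def distrib_left)
      moreover have "(\<Prod>i<N. o' j - e i) \<noteq> 0" using eo by auto
      ultimately show ?thesis by (simp add: f1(2) g1(2) power_mult_distrib)
    qed
    have "(\<lambda>z. (g1 z)\<^sup>2 - (f1 z)\<^sup>2) holomorphic_on UNIV"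
      using f1(1) g1(1) by (intro holomorphic_intros)
    then obtain G where G: "G holomorphic_on UNIV"
      "\<And>z. (g1 z)\<^sup>2 - (f1 z)\<^sup>2 = (\<Prod>j<N. z - o' j) * G z"
      using entire_factor_prod[where h = "\<lambda>z. (g1 z)\<^sup>2 - (f1 z)\<^sup>2", OF _ finite_lessThan inj_N(2) o_zero]
      by blast
    have prod_a: "(\<Prod>n<3*N. z - of_real (a n)) = (\<Prod>j<N. z - e j)\<^sup>2 * (\<Prod>j<N. z - o' j)" for z
    proof (induction N)
      case (Suc N)
      have 3: "3 * Suc N = Suc (Suc (Suc (3 * N)))" by simp
      have "Suc (3 * N) div 3 = N" "Suc (3 * N) mod 3 = 1" "Suc (Suc (3 * N)) div 3 = N"
        "Suc (Suc (3 * N)) mod 3 = 2" by presburger+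
      then have "of_real (a (3 * N)) = e N" "of_real (a (Suc (3 * N))) = e N"
        "of_real (a (Suc (Suc (3 * N)))) = o' N"
        by (simp_all add: a_def e_def o'_def)
      then show ?case
        unfolding 3 prod.lessThan_Suc Suc.IH by (simp add: power2_eq_square mult_ac)
    qed simp
    have "F z = (\<Prod>n<3*N. z - of_real (a n)) * G z" for z
    proof -
      have "F z = (\<Prod>j<N. z - e j)\<^sup>2 * ((g1 z)\<^sup>2 - (f1 z)\<^sup>2)"
        by (simp add: F_def f1(2) g1(2) power_mult_distrib right_diff_distrib)
      then show ?thesis unfolding prod_a by (simp add: G(2) mult_ac)
    qed
    then show ?thesis using G(1) by blast
  qed
  \<comment> \<open>The surplus factors between \<open>N\<close> and \<open>3 * N\<close> are moved
    into the cofactor.\<close>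
  have zeros: "\<exists>G. G holomorphic_on UNIV \<and> (\<forall>z. F z = (\<Prod>n<N. z - of_real (a n)) * G z)" for N
  proof -
    obtain G where G: "G holomorphic_on UNIV" "\<And>z. F z = (\<Prod>n<3*N. z - of_real (a n)) * G z"
      using zeros3 by blast
    have "(\<lambda>z. (\<Prod>n\<in>{N..<3*N}. z - of_real (a n)) * G z) holomorphic_on UNIV"
      using G(1) by (intro holomorphic_intros)
    moreover have "F z = (\<Prod>n<N. z - of_real (a n)) * ((\<Prod>n\<in>{N..<3*N}. z - of_real (a n)) * G z)" for z
    proof -
      have "(\<Prod>n<3*N. z - of_real (a n)) = (\<Prod>n\<in>{..<N} \<union> {N..<3*N}. z - of_real (a n))"
        by (intro prod.cong) auto
      also have "\<dots> = (\<Prod>n<N. z - of_real (a n)) * (\<Prod>n\<in>{N..<3*N}. z - of_real (a n))"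
        by (intro prod.union_disjoint) auto
      finally show ?thesis by (simp add: G(2) mult.assoc)
    qed
    ultimately show ?thesis by blast
  qed
  have F0: "F z = 0"
  \<comment> \<open>Squaring doubles the type; three entries of \<open>a\<close> per two indices
    give \<open>D\<close>. The index used by entry n is at most 2 n0 + 1 + 2n/3, which gives
    \<open>K\<close>.\<close>
  proof (rule carlson_uniqueness[where F = F and a = a and C = "2 * C\<^sup>2" and \<tau> = "2 * \<beta>" and \<rho> = 1 and
        D = "3 / 2 * d" and K = "(2 * of_int n0 + 1) / d + L"])
    show "F holomorphic_on UNIV" unfolding F_def using hol by (intro holomorphic_intros)
    show "cmod (F z) \<le> 2 * C\<^sup>2 * exp (2 * \<beta> * cmod z)" for z
    proof -
      have sq: "(C * exp (\<beta> * cmod z))\<^sup>2 = C\<^sup>2 * exp (2 * \<beta> * cmod z)"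
        by (simp add: power_mult_distrib mult_ac flip: exp_of_nat_mult)
      have "cmod (F z) \<le> (cmod (g z))\<^sup>2 + (cmod (f z))\<^sup>2"
        unfolding F_def norm_power[symmetric] by (rule norm_triangle_ineq4)
      also have "\<dots> \<le> (C * exp (\<beta> * cmod z))\<^sup>2 + (C * exp (\<beta> * cmod z))\<^sup>2"
        by (intro add_mono power_mono bound) auto
      finally show ?thesis unfolding sq by simp
    qed
    show "a n \<ge> 1" for n
    proof -
      have "d * (L + 1) \<le> of_int n0" unfolding n0_def by (rule le_of_int_ceiling)
      moreover have "0 \<le> d * (L + 1)" using d L by simp
      ultimately have "d * (L + 1) \<le> of_int (2 * n0)" "0 \<le> n0" by simp_all
      then have "L + 1 \<le> of_int (2 * n0) / d" using d by (simp add: field_simps)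
      then have "1 \<le> x (2 * n0)" using near[of "2 * n0"] by linarith
      also have "\<dots> \<le> a n"
        unfolding a_def using strict_mono_mono[OF mono] by (auto intro: monoD)
      finally show ?thesis .
    qed
    show "a n \<le> real n / (3 / 2 * d) + ((2 * of_int n0 + 1) / d + L)" for n
    proof -
      let ?i = "2 * n0 + 2 * int (n div 3) + (if n mod 3 = 2 then 1 else 0)"
      have "n = 3 * (n div 3) + n mod 3" by simp
      then have "real n = 3 * real (n div 3) + real (n mod 3)"
        by (metis of_nat_add of_nat_mult of_nat_numeral)
      moreover have "real_of_int ?i \<le> 2 * of_int n0 + 2 * real (n div 3) + 1" by simp
      ultimately have "real_of_int ?i \<le> 2 * of_int n0 + 1 + 2 / 3 * real n" by linarith
      then have "real_of_int ?i / d \<le> (2 * of_int n0 + 1 + 2 / 3 * real n) / d"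
        using d by (intro divide_right_mono) auto
      also have "\<dots> = real n / (3 / 2 * d) + (2 * of_int n0 + 1) / d"
        using d by (simp add: field_simps)
      finally show ?thesis using near[of ?i] unfolding a_def by linarith
    qed
  qed (use \<beta> zeros in auto)
  then show ?thesis by (simp add: F_def)
qed

lemma Reals_cmod_eq_imp_square_eq:
  assumes "u \<in> \<real>" "v \<in> \<real>" "cmod u = cmod v"
  shows "u\<^sup>2 = v\<^sup>2"
  using assms by (auto elim!: Reals_cases simp: power2_eq_iff abs_eq_iff simp flip: of_real_power)

theorem theorem2:
  fixes p :: ennreal and b :: real and x :: "int \<Rightarrow> real"
  assumes "p > 0" and "b > 0"
    and "\<forall>k. x k < x (k + 1)"
    and "separated_seq x"
    and "seq_density x < ereal (2 * b)"
  shows "(\<exists>f \<in> PW p b. real_on_reals f \<and>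
            (\<exists>g \<in> PW p b. real_on_reals g \<and>
               (\<forall>k. cmod (g (complex_of_real (x k))) = cmod (f (complex_of_real (x k)))) \<and>
               g \<noteq> f \<and> g \<noteq> (\<lambda>z. - f z)))
       \<and> (seq_density x > ereal (4 / 3 * b) \<longrightarrow>
          (\<exists>f \<in> PW p b. real_on_reals f \<and>
            (\<forall>g \<in> PW p b. real_on_reals g \<longrightarrow>
               (\<forall>k. cmod (g (complex_of_real (x k))) = cmod (f (complex_of_real (x k)))) \<longrightarrow>
               g = f \<or> g = (\<lambda>z. - f z)) \<and>
            \<not> (\<exists>Y \<subseteq> range x. (\<forall>y \<in> Y. f (complex_of_real y) = 0) \<and>
                 (\<exists>L::real. ((\<lambda>r::real. real (count_in Y {-r..r}) / (2 * r)) \<longlongrightarrow> L) at_top \<and>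
                    L \<ge> b))))"
proof -
  obtain d where ud: "uniformly_dense_with x d"
    using assms(5) by (auto simp: seq_density_def split: if_splits)
  have density: "seq_density x = ereal d" by (rule seq_density_eq[OF ud])
  have d: "0 < d" "d < 2 * b"
    using ud assms(5) by (auto simp: uniformly_dense_with_def density)
  obtain L where L: "\<And>k. \<bar>x k - of_int k / d\<bar> \<le> L"
    using ud by (auto simp: uniformly_dense_with_def bdd_above_def)
  obtain \<sigma> where \<sigma>: "\<sigma> > 0" "\<And>i j. \<sigma> * \<bar>of_int (i - j)\<bar> \<le> \<bar>x i - x j\<bar>"
    using separated_seq_imp_dist_ge[OF assms(4,3)] by blast
  have mono: "strict_mono x"
  proof (rule strict_monoI)
    fix i j :: int assume "i < j"
    then show "x i < x j"
    proof (induction rule: int_less_induct)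
      case base
      then show ?case using assms(3)[rule_format, of "j - 1"] by simp
    next
      case (step i)
      then show ?case using assms(3)[rule_format, of "i - 1"] by simp
    qed
  qed
  \<comment> \<open>For p = \<infinity> both \<open>enn2real p\<close> and the quotient default to
    0, so \<open>m\<close> is 0 and the decay bound is mere boundedness on the real line.\<close>
  define m where "m = nat \<lceil>2 / enn2real p\<rceil>"
  have m: "real m * enn2real p \<ge> 2" if "p \<noteq> \<infinity>"
  proof -
    have "enn2real p > 0"
      using assms(1) that by (simp add: enn2real_positive_iff top.not_eq_extremum)
    moreover have "2 / enn2real p \<le> real m" unfolding m_def by linarith
    ultimately show ?thesis by (simp add: field_simps)
  qed
  note PW_I' = PW_I[OF _ _ assms(2) m]
  have \<delta>: "0 < d / 2" "d / 2 < b" using d by auto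
  define xe where "xe k = x (2 * k)" for k
  define xo where "xo k = x (2 * k + 1)" for k
  have xe_near: "\<bar>xe k - of_int k / (d / 2)\<bar> \<le> L" for k
    using L[of "2 * k"] by (simp add: xe_def mult.commute)
  have xo_near: "\<bar>xo k - of_int k / (d / 2)\<bar> \<le> L + 1 / d" for k
  proof -
    have "xo k - of_int k / (d / 2) = (x (2 * k + 1) - of_int (2 * k + 1) / d) + 1 / d"
      by (simp add: xo_def add_divide_distrib)
    moreover have "1 / d > 0" using d by simp
    ultimately show ?thesis using L[of "2 * k + 1"] by linarith
  qed
  have sep_half: "\<sigma> * \<bar>of_int k\<bar> \<le> \<bar>x (2 * k + i) - x (2 * 0 + i)\<bar>" for k i
  proof -
    have "\<sigma> * \<bar>of_int k\<bar> \<le> \<sigma> * \<bar>of_int ((2 * k + i) - (2 * 0 + i))\<bar>"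
      using \<sigma>(1) by (intro mult_left_mono) auto
    then show ?thesis using \<sigma>(2)[of "2 * k + i" "2 * 0 + i"] by linarith
  qed
  have xe_sep: "\<sigma> * \<bar>of_int k\<bar> \<le> \<bar>xe k - xe 0\<bar>" and xo_sep: "\<sigma> * \<bar>of_int k\<bar> \<le> \<bar>xo k - xo 0\<bar>" for k
    using sep_half[of k 0] sep_half[of k 1] by (simp_all add: xe_def xo_def)
  obtain u Cu \<eta> where u: "u holomorphic_on UNIV" "real_on_reals u"
    "\<And>z. cmod (u z) \<le> Cu * exp (pi * b * \<bar>Im z\<bar>) / (1 + cmod z) ^ m"
    "\<And>k. u (of_real (xe k)) = 0" "\<eta> > 0" "d / 2 + \<eta> / pi < b"
    "\<And>t::real. u (of_real t) = 0 \<Longrightarrow> t \<in> range xe \<or> sin (\<eta> * (t - xe 0)) = 0"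
    using decaying_function_with_zeros[OF \<delta> xe_near \<sigma>(1) xe_sep] by metis
  obtain v Cv \<eta>' where v: "v holomorphic_on UNIV" "real_on_reals v"
    "\<And>z. cmod (v z) \<le> Cv * exp (pi * b * \<bar>Im z\<bar>) / (1 + cmod z) ^ m"
    "\<And>k. v (of_real (xo k)) = 0" "\<eta>' > 0"
    "\<And>t::real. v (of_real t) = 0 \<Longrightarrow> t \<in> range xo \<or> sin (\<eta>' * (t - xo 0)) = 0"
    using decaying_function_with_zeros[OF \<delta> xo_near \<sigma>(1) xo_sep] by metis
  obtain zu where zu: "u zu \<noteq> 0" using nonzero_of_zeros_countable[OF u(5,7)] by blast
  obtain zv where zv: "v zv \<noteq> 0" using nonzero_of_zeros_countable[OF v(5,6)] by blast
  show ?thesis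
  proof (intro conjI impI)
    define f where "f z = u z + v z" for z
    define g where "g z = u z - v z" for z
    have bound: "cmod (f z) \<le> (Cu + Cv) * exp (pi * b * \<bar>Im z\<bar>) / (1 + cmod z) ^ m"
      "cmod (g z) \<le> (Cu + Cv) * exp (pi * b * \<bar>Im z\<bar>) / (1 + cmod z) ^ m" for z
      using u(3)[of z] v(3)[of z] norm_triangle_ineq[of "u z" "v z"] norm_triangle_ineq4[of "u z" "v z"]
      by (simp_all add: f_def g_def distrib_right add_divide_distrib)
    have "f holomorphic_on UNIV" "g holomorphic_on UNIV"
      unfolding f_def g_def
      by (rule holomorphic_on_add[OF u(1) v(1)] holomorphic_on_diff[OF u(1) v(1)])+
    then have "f \<in> PW p b" "g \<in> PW p b"
      using bound by (blast intro: PW_I')+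
    moreover have "real_on_reals f" "real_on_reals g"
      using u(2) v(2) by (auto simp: real_on_reals_def f_def g_def)
    \<comment> \<open>At even indices g = -f, at odd ones g = f; nonvanishing of \<open>v\<close>
      and of \<open>u\<close> somewhere rules out either identity globally.\<close>
    moreover have "cmod (g (of_real (x k))) = cmod (f (of_real (x k)))" for k
    proof (cases "even k")
      case True
      then obtain j where "k = 2 * j" by blast
      then have "u (of_real (x k)) = 0" using u(4)[of j] by (simp add: xe_def)
      then show ?thesis by (simp add: f_def g_def)
    next
      case False
      then obtain j where "k = 2 * j + 1" by (blast elim: oddE)
      then have "v (of_real (x k)) = 0" using v(4)[of j] by (simp add: xo_def)
      then show ?thesis by (simp add: f_def g_def)
    qed
    moreover have "g \<noteq> f"
    proof
      assume "g = f"
      then have "g zv = f zv" by simp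
      then show False using zv by (simp add: f_def g_def)
    qed
    moreover have "g \<noteq> (\<lambda>z. - f z)"
    proof
      assume "g = (\<lambda>z. - f z)"
      then have "g zu = - f zu" by simp
      then show False using zu by (simp add: f_def g_def)
    qed
    ultimately show "\<exists>f \<in> PW p b. real_on_reals f \<and>
            (\<exists>g \<in> PW p b. real_on_reals g \<and>
               (\<forall>k. cmod (g (complex_of_real (x k))) = cmod (f (complex_of_real (x k)))) \<and>
               g \<noteq> f \<and> g \<noteq> (\<lambda>z. - f z))"
      by blast
  next
    assume "seq_density x > ereal (4 / 3 * b)"
    then have d_gt: "b < 3 / 4 * d" by (simp add: density)
    have uPW: "u \<in> PW p b" by (rule PW_I'[OF u(1) u(3)])
    have unique: "g = u \<or> g = (\<lambda>z. - u z)"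
      if g: "g \<in> PW p b" "real_on_reals g" and eq: "\<forall>k. cmod (g (of_real (x k))) = cmod (u (of_real (x k)))" for g
    proof -
      \<comment> \<open>Room for a growth exponent above the type that still satisfies 2 \<beta> /
        pi < 3d/2; it exists exactly because d > 4b/3.\<close>
      obtain \<beta> where \<beta>: "pi * b < \<beta>" "\<beta> < pi * (3 / 4 * d)"
        using dense[of "pi * b" "pi * (3 / 4 * d)"] d_gt by auto
      obtain C1 where C1: "\<And>z. cmod (g z) \<le> C1 * exp (\<beta> * cmod z)"
        using PW_growth[OF g(1) \<beta>(1)] by blast
      obtain C2 where C2: "\<And>z. cmod (u z) \<le> C2 * exp (\<beta> * cmod z)"
        using PW_growth[OF uPW \<beta>(1)] by blast
      define C where "C = max C1 C2"
      have bounds: "cmod (u z) \<le> C * exp (\<beta> * cmod z)" "cmod (g z) \<le> C * exp (\<beta> * cmod z)" for z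
        unfolding C_def by (rule order_trans[OF C2] order_trans[OF C1]; intro mult_right_mono; simp)+
      have holg: "g holomorphic_on UNIV" using g(1) by (simp add: PW_def)
      have sq: "(g z)\<^sup>2 = (u z)\<^sup>2" for z
      proof (rule square_eq_of_abs_eq[OF u(1) holg bounds _ _ mono L d(1)])
        show "0 \<le> \<beta>" using \<beta>(1) assms(2) mult_pos_pos[OF pi_gt_zero assms(2)] by linarith
        show "2 * \<beta> / pi < 3 / 2 * d" using \<beta>(2) by (simp add: field_simps)
        show u0: "u (of_real (x (2 * k))) = 0" for k using u(4)[of k] by (simp add: xe_def)
        show "g (of_real (x (2 * k))) = 0" for k
          using eq[rule_format, of "2 * k"] u0[of k] by simp
        show "(g (of_real (x (2 * k + 1))))\<^sup>2 = (u (of_real (x (2 * k + 1))))\<^sup>2" for k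
          using g(2) u(2) eq by (intro Reals_cmod_eq_imp_square_eq) (auto simp: real_on_reals_def)
      qed
      have "(\<forall>z. g z - u z = 0) \<or> (\<forall>z. g z + u z = 0)"
      proof (rule entire_mult_eq_0)
        show "(\<lambda>z. g z - u z) holomorphic_on UNIV" "(\<lambda>z. g z + u z) holomorphic_on UNIV"
          by (rule holomorphic_on_diff[OF holg u(1)] holomorphic_on_add[OF holg u(1)])+
        show "(g z - u z) * (g z + u z) = 0" for z
          using sq[of z] by (simp add: power2_eq_square algebra_simps)
      qed
      then show ?thesis by (auto simp: fun_eq_iff eq_neg_iff_add_eq_0)
    qed
    have "\<not> L' \<ge> b" if "\<forall>y \<in> Y. u (complex_of_real y) = 0"
      "((\<lambda>r::real. real (count_in Y {-r..r}) / (2 * r)) \<longlongrightarrow> L') at_top" for Y L'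
      using zeros_density_le[OF \<delta>(1) xe_near u(5,7) that] u(6) by linarith
    then show "\<exists>f \<in> PW p b. real_on_reals f \<and>
            (\<forall>g \<in> PW p b. real_on_reals g \<longrightarrow>
               (\<forall>k. cmod (g (complex_of_real (x k))) = cmod (f (complex_of_real (x k)))) \<longrightarrow>
               g = f \<or> g = (\<lambda>z. - f z)) \<and>
            \<not> (\<exists>Y \<subseteq> range x. (\<forall>y \<in> Y. f (complex_of_real y) = 0) \<and>
                 (\<exists>L::real. ((\<lambda>r::real. real (count_in Y {-r..r}) / (2 * r)) \<longlongrightarrow> L) at_top \<and>
                    L \<ge> b))"
      using uPW u(2) unique by blast
  qed
qed

end
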